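(* There exists an absolute constant $C>0$ such that the following holds. Let $n,t$ be positive integers with $n\ge C t\log^2 t$, and let $\mathcal{F}\subset\mathcal{B}_n$ be a $t$-intersecting family of partitions of $[n]$. Then $|\mathcal{F}|\le B_{n-t}$, and equality is only possible if $\mathcal{F}$ is the family of all partitions of $[n]$ that contain $\{x_1\},\ldots,\{x_t\}$ as parts, for some $t$ distinct elements $x_1,\ldots,x_t\in[n]$.
   Context: $[n]=\{1,\ldots,n\}$. $\mathcal{B}_n$ denotes the family of all partitions of $[n]$ (into any number of nonempty parts), and $B_m=|\mathcal{B}_m|$ is the $m$-th Bell number. Two partitions $P,Q$ of $[n]$ are $t$-intersecting if they share at least $t$ parts (i.e., there are $t$ distinct parts of $P$ each of which is also a part of $Q$). A family of partitions is $t$-intersecting if any two partitions in it are $t$-intersecting.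
   Formalization: The characterization of equality is not claimed for n = 2, t = 1, where it fails: the family consisting only of the partition {{1,2}} has size 1 = B_1 but contains no singleton part; the bound is still proved there. *)

theory Defs
  imports Complex_Main "HOL-Library.Disjoint_Sets"
begin

definition set_partitions :: "nat \<Rightarrow> nat set set set" where
  "set_partitions n = {P. partition_on {1..n} P}"

definition Bell :: "nat \<Rightarrow> nat" where
  "Bell m = card (set_partitions m)"

definition t_intersecting :: "nat \<Rightarrow> 'a set set \<Rightarrow> 'a set set \<Rightarrow> bool" where
  "t_intersecting t P Q \<longleftrightarrow> (\<exists>S. S \<subseteq> P \<inter> Q \<and> finite S \<and> card S = t)"

(* Only distinct members are compared, so a family with at most one member always qualifies. *)
definition t_intersecting_family :: "nat \<Rightarrow> 'a set set set \<Rightarrow> bool" where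
  "t_intersecting_family t \<F> \<longleftrightarrow> pairwise (t_intersecting t) \<F>"

end

theory Submission
  imports Defs "HOL-Real_Asymp.Real_Asymp"
begin

text \<open>
  Splitting a point off its block, applied as a compression, turns the family into one of the same size
  in which the sets of singletons of any two members meet in \<open>t\<close> points. So it suffices to bound the
  number of partitions whose set of singletons lies in a \<open>t\<close>-intersecting family \<open>G\<close> of subsets of
  \<open>{1..n}\<close>. If \<open>G\<close> contains a \<open>t\<close>-set, all members of \<open>G\<close> contain it. Otherwise \<open>G\<close> may
  be replaced by a left-shifted family, whose members \<open>S\<close> satisfy \<open>card (S \<inter> {1..t + 2 * l}) = t + l\<close>
  for some \<open>l\<close>. A union bound over \<open>l\<close> together with Dobinski's formula, which controls the ratios of
  Bell numbers, gives a strict inequality for \<open>t \<ge> 2\<close>. For \<open>t = 1\<close> it follows for all \<open>n \<ge> 3\<close> from the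
  Erdos-Ko-Rado theorem for the levels of \<open>G\<close>.
\<close>

section \<open>Counting partitions by their singletons\<close>

text \<open>A set \<open>S\<close> gets as weight the number of partitions with
  \<open>sing P = S\<close>. This is \<open>bell0 (n - card S)\<close>, so it depends on the size
  alone, and shifting, which keeps the sizes of the levels, leaves the total unchanged. With
  \<open>n = t + m\<close>, prescribing one more singleton costs a factor of order
  \<open>ln m / m\<close>, against order \<open>t\<close> choices for each further deviation of a
  shifted set from \<open>{1..t}\<close>; this is where \<open>t\<close> times a logarithm enters.
  For \<open>t = 1\<close> the size condition is void because \<open>ln 1 = 0\<close>, hence a
  separate argument that covers every \<open>n\<close>.

  Strictness is delicate because a family without a \<open>t\<close>-set may still be almost the
  whole star of \<open>{1..t}\<close>. Omitting the set \<open>{1..t}\<close> frees only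
  \<open>bell0 m\<close> partitions, bounded below here by \<open>Bell m / m^2\<close>, so the
  members outside the star must stay below that amount and not just below a fraction of
  \<open>Bell m\<close>. Uniqueness meets a second obstacle: compression forgets the original
  family, so it has to be excluded that splitting turns another family into a star.\<close>

definition sing :: "'a set set \<Rightarrow> 'a set" where
  "sing P = {x. {x} \<in> P}"

definition bell0 :: "nat \<Rightarrow> nat" where
  "bell0 m = card {P \<in> set_partitions m. sing P = {}}"

lemma in_sing [simp]: "x \<in> sing P \<longleftrightarrow> {x} \<in> P"
  by (simp add: sing_def)

lemma sing_subset: "partition_on A P \<Longrightarrow> sing P \<subseteq> A"
  by (auto simp: partition_on_def)

lemma finite_set_partitions [simp]: "finite (set_partitions n)"
  by (simp add: set_partitions_def finitely_many_partition_on)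

lemma set_partitions_block_subset: "P \<in> set_partitions n \<Longrightarrow> p \<in> P \<Longrightarrow> p \<subseteq> {1..n}"
  by (auto simp: set_partitions_def partition_on_def)

lemma partition_on_block_eq:
  "partition_on A P \<Longrightarrow> p \<in> P \<Longrightarrow> q \<in> P \<Longrightarrow> x \<in> p \<Longrightarrow> x \<in> q \<Longrightarrow> p = q"
  by (auto simp: partition_on_def disjoint_def)

lemma partition_on_Diff:
  assumes P: "partition_on A P" and "Q \<subseteq> P"
  shows "partition_on (A - \<Union>Q) (P - Q)"
proof (rule partition_onI)
  have "p \<inter> \<Union>Q = {}" if "p \<in> P - Q" for p
    using that \<open>Q \<subseteq> P\<close> partition_on_block_eq[OF P] by blast
  then show "\<Union>(P - Q) = A - \<Union>Q"
    using partition_onD1[OF P] \<open>Q \<subseteq> P\<close> by blast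
  show "disjnt p q" if "p \<in> P - Q" "q \<in> P - Q" "p \<noteq> q" for p q
    using that P by (auto simp: partition_on_def pairwise_def)
qed (use P in \<open>auto simp: partition_on_def\<close>)

lemma partition_on_image:
  assumes "inj_on f A" "partition_on A P"
  shows "partition_on (f ` A) ((`) f ` P)"
proof -
  have "{} \<notin> (`) f ` P" using assms(2) by (auto simp: partition_on_def)
  then show ?thesis using partition_on_inj_image[OF assms(2,1)] by simp
qed

lemma sing_image:
  assumes "inj_on f A" "partition_on A P"
  shows "sing ((`) f ` P) = f ` sing P"
proof -
  have "x \<in> f ` sing P" if p: "p \<in> P" "f ` p = {x}" for x p
  proof -
    have "p \<subseteq> A" using p assms by (auto simp: partition_on_def)
    then have "inj_on f p" using assms(1) inj_on_subset by blast
    then have "card p = 1" using card_image[of f p] p(2) by simp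
    then obtain y where "p = {y}" by (auto simp: card_1_singleton_iff)
    then show ?thesis using p by auto
  qed
  then show ?thesis by (auto simp: image_iff) (metis image_empty image_insert)
qed

text \<open>\<open>R\<close> takes a truth value so that relabelling along a bijection is proved
  once: constantly true, it counts all partitions; as the identity, those without singleton
  parts.\<close>

lemma card_partitions_transfer:
  assumes "bij_betw f A B"
  shows "card {P. partition_on A P \<and> R (sing P = {})} = card {P. partition_on B P \<and> R (sing P = {})}"
proof -
  have inj: "inj_on f A" and im: "f ` A = B" using assms by (auto simp: bij_betw_def)
  let ?g = "the_inv_into A f"
  have ginj: "inj_on ?g B" and gim: "?g ` B = A"
    using bij_betw_the_inv_into[OF assms] by (auto simp: bij_betw_def)
  have gf: "(`) ?g ` (`) f ` P = P" if "partition_on A P" for P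
  proof -
    have "?g ` f ` p = p" if "p \<in> P" for p
    proof -
      have "p \<subseteq> A" using \<open>partition_on A P\<close> that by (auto simp: partition_on_def)
      then show ?thesis using inj by (force simp: image_image the_inv_into_f_f)
    qed
    then show ?thesis by (simp add: image_image)
  qed
  have fg: "(`) f ` (`) ?g ` P = P" if "partition_on B P" for P
  proof -
    have "f ` ?g ` p = p" if "p \<in> P" for p
    proof -
      have "p \<subseteq> B" using \<open>partition_on B P\<close> that by (auto simp: partition_on_def)
      then show ?thesis using inj im by (force simp: image_image f_the_inv_into_f)
    qed
    then show ?thesis by (simp add: image_image)
  qed
  have "bij_betw ((`) ((`) f)) {P. partition_on A P \<and> R (sing P = {})} {P. partition_on B P \<and> R (sing P = {})}"
  proof (rule bij_betw_byWitness[where f' = "(`) ((`) ?g)"])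
    show "(`) ((`) f) ` {P. partition_on A P \<and> R (sing P = {})} \<subseteq> {P. partition_on B P \<and> R (sing P = {})}"
      using partition_on_image[OF inj] im by (auto simp: sing_image[OF inj])
    show "(`) ((`) ?g) ` {P. partition_on B P \<and> R (sing P = {})} \<subseteq> {P. partition_on A P \<and> R (sing P = {})}"
      using partition_on_image[OF ginj] gim by (auto simp: sing_image[OF ginj])
  qed (use fg gf in auto)
  then show ?thesis by (rule bij_betw_same_card)
qed

lemma card_partition_on:
  assumes "finite A"
  shows "card {P. partition_on A P} = Bell (card A)"
proof -
  obtain f where "bij_betw f A {1..card A}"
    using assms by (metis card_atLeastAtMost diff_Suc_1 finite_atLeastAtMost finite_same_card_bij)
  from card_partitions_transfer[OF this, of "\<lambda>_. True"] show ?thesis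
    by (simp add: Bell_def set_partitions_def)
qed

lemma card_partition_on_no_sing:
  assumes "finite A"
  shows "card {P. partition_on A P \<and> sing P = {}} = bell0 (card A)"
proof -
  obtain f where "bij_betw f A {1..card A}"
    using assms by (metis card_atLeastAtMost diff_Suc_1 finite_atLeastAtMost finite_same_card_bij)
  from card_partitions_transfer[OF this, of "\<lambda>b. b"] show ?thesis
    by (simp add: bell0_def set_partitions_def)
qed

text \<open>Deleting the singleton parts on \<open>E\<close> is reversible. The free predicate
  \<open>R\<close> serves two counts: always true, it gives the partitions with
  \<open>E \<subseteq> sing P\<close>; as \<open>X = {}\<close>, those with
  \<open>sing P = E\<close>.\<close>

lemma partition_on_add_singletons:
  assumes "E \<subseteq> A"
  shows "bij_betw (\<lambda>Q. Q \<union> (\<lambda>x. {x}) ` E) {Q. partition_on (A - E) Q \<and> R (sing Q)}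
     {P. partition_on A P \<and> E \<subseteq> sing P \<and> R (sing P - E)}"
proof (rule bij_betw_byWitness[where f' = "\<lambda>P. P - (\<lambda>x. {x}) ` E"])
  show "\<forall>a\<in>{Q. partition_on (A - E) Q \<and> R (sing Q)}. a \<union> (\<lambda>x. {x}) ` E - (\<lambda>x. {x}) ` E = a"
    by (auto simp: partition_on_def)
  show "\<forall>a'\<in>{P. partition_on A P \<and> E \<subseteq> sing P \<and> R (sing P - E)}. a' - (\<lambda>x. {x}) ` E \<union> (\<lambda>x. {x}) ` E = a'"
    by auto
  have "partition_on A (Q \<union> (\<lambda>x. {x}) ` E)" if "partition_on (A - E) Q" for Q
    using that assms by (auto simp: partition_on_def disjoint_def) blast+
  moreover have "sing (Q \<union> (\<lambda>x. {x}) ` E) - E = sing Q" if "partition_on (A - E) Q" for Q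
    using sing_subset[OF that] by auto
  ultimately show "(\<lambda>Q. Q \<union> (\<lambda>x. {x}) ` E) ` {Q. partition_on (A - E) Q \<and> R (sing Q)}
    \<subseteq> {P. partition_on A P \<and> E \<subseteq> sing P \<and> R (sing P - E)}"
    by auto
  have 1: "partition_on (A - E) (P - (\<lambda>x. {x}) ` E)" if P: "partition_on A P" "E \<subseteq> sing P" for P
  proof -
    have "(\<lambda>x. {x}) ` E \<subseteq> P" using P(2) by auto
    from partition_on_Diff[OF P(1) this] show ?thesis by simp
  qed
  have 2: "sing (P - (\<lambda>x. {x}) ` E) = sing P - E" for P by auto
  show "(\<lambda>P. P - (\<lambda>x. {x}) ` E) ` {P. partition_on A P \<and> E \<subseteq> sing P \<and> R (sing P - E)}
    \<subseteq> {Q. partition_on (A - E) Q \<and> R (sing Q)}"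
    by (auto simp only: image_subset_iff mem_Collect_eq 2 intro: 1)
qed

lemma card_sing_superset:
  assumes "E \<subseteq> {1..n}"
  shows "card {P \<in> set_partitions n. E \<subseteq> sing P} = Bell (n - card E)"
proof -
  have "card {P \<in> set_partitions n. E \<subseteq> sing P} = card {Q. partition_on ({1..n} - E) Q}"
    using bij_betw_same_card[OF partition_on_add_singletons[OF assms, of "\<lambda>_. True"]]
    by (simp add: set_partitions_def)
  also have "\<dots> = Bell (card ({1..n} - E))" by (rule card_partition_on) simp
  also have "card ({1..n} - E) = n - card E"
    using assms by (simp add: card_Diff_subset finite_subset)
  finally show ?thesis .
qed

lemma card_sing_eq:
  assumes "E \<subseteq> {1..n}"
  shows "card {P \<in> set_partitions n. sing P = E} = bell0 (n - card E)"
proof -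
  have "{P \<in> set_partitions n. sing P = E} = {P. partition_on {1..n} P \<and> E \<subseteq> sing P \<and> sing P - E = {}}"
    by (auto simp: set_partitions_def)
  then have "card {P \<in> set_partitions n. sing P = E} = card {Q. partition_on ({1..n} - E) Q \<and> sing Q = {}}"
    using bij_betw_same_card[OF partition_on_add_singletons[OF assms, of "\<lambda>X. X = {}"]]
    by simp
  also have "\<dots> = bell0 (card ({1..n} - E))" by (rule card_partition_on_no_sing) simp
  also have "card ({1..n} - E) = n - card E"
    using assms by (simp add: card_Diff_subset finite_subset)
  finally show ?thesis .
qed

lemma card_sing_family:
  assumes "G \<subseteq> Pow {1..n}"
  shows "card {P \<in> set_partitions n. sing P \<in> G} = (\<Sum>S\<in>G. bell0 (n - card S))"
proof -
  have fin: "finite G" using assms by (rule finite_subset) simp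
  have "{P \<in> set_partitions n. sing P \<in> G} = (\<Union>S\<in>G. {P \<in> set_partitions n. sing P = S})" by auto
  also have "card \<dots> = (\<Sum>S\<in>G. card {P \<in> set_partitions n. sing P = S})"
    by (rule card_UN_disjoint) (use fin in auto)
  also have "\<dots> = (\<Sum>S\<in>G. bell0 (n - card S))"
    by (rule sum.cong) (use assms card_sing_eq in auto)
  finally show ?thesis .
qed

lemma sum_by_card:
  fixes h :: "nat \<Rightarrow> nat"
  assumes "G \<subseteq> Pow {1..n}"
  shows "(\<Sum>S\<in>G. h (card S)) = (\<Sum>k\<le>n. card {S \<in> G. card S = k} * h k)"
proof -
  have fin: "finite G" using assms by (rule finite_subset) simp
  have "card S \<le> n" if "S \<in> G" for S
    using assms that card_mono[of "{1..n}" S] by auto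
  then have "(\<Sum>S\<in>G. h (card S)) = (\<Sum>k\<le>n. \<Sum>S\<in>{S \<in> G. card S = k}. h (card S))"
    by (subst sum.group) (use fin in auto)
  then show ?thesis by simp
qed

section \<open>Bell numbers and the numbers of partitions without singletons\<close>

lemma Bell_0 [simp]: "Bell 0 = 1"
  by (simp add: Bell_def set_partitions_def partition_on_empty)

text \<open>Partitions are classified by the block of \<open>m + 1\<close>: \<open>D\<close> is the
  set of points outside that block and \<open>Q\<close> the partition that they carry.\<close>

lemma Bell_Suc: "Bell (Suc m) = (\<Sum>k\<le>m. (m choose k) * Bell k)"
proof -
  let ?A = "{1..m}" and ?x = "Suc m"
  let ?S = "SIGMA D:Pow ?A. {Q. partition_on D Q}"
  let ?f = "\<lambda>(D, Q). insert (insert ?x (?A - D)) Q"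
  let ?block = "\<lambda>P. THE p. p \<in> P \<and> ?x \<in> p"
  have "bij_betw ?f ?S (set_partitions (Suc m))"
    unfolding bij_betw_def
  proof
    show "inj_on ?f ?S"
    proof (rule inj_onI, clarsimp)
      fix D D' Q Q'
      assume a: "D \<subseteq> {Suc 0..m}" "D' \<subseteq> {Suc 0..m}" "partition_on D Q" "partition_on D' Q'"
        "insert (insert ?x ({Suc 0..m} - D)) Q = insert (insert ?x ({Suc 0..m} - D')) Q'"
      have n: "?x \<notin> p" if "p \<in> Q \<or> p \<in> Q'" for p
        using a(1-4) that by (fastforce simp: partition_on_def)
      have e: "insert ?x ({Suc 0..m} - D) = insert ?x ({Suc 0..m} - D')"
      proof -
        have "insert ?x ({Suc 0..m} - D) \<in> insert (insert ?x ({Suc 0..m} - D')) Q'"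
          using a(5) by (metis insertI1)
        moreover have "insert ?x ({Suc 0..m} - D) \<notin> Q'" using n by (metis insertI1)
        ultimately show ?thesis by simp
      qed
      then have "{Suc 0..m} - D = {Suc 0..m} - D'"
        by (subst (asm) insert_eq_iff) auto
      then have "D = D'" using a by blast
      moreover have "Q = Q'"
      proof -
        have "insert ?x ({Suc 0..m} - D) \<notin> Q" "insert ?x ({Suc 0..m} - D) \<notin> Q'"
          using n by (metis insertI1)+
        then show ?thesis using a(5) e by (metis Diff_insert_absorb)
      qed
      ultimately show "D = D' \<and> Q = Q'" by simp
    qed
    show "?f ` ?S = set_partitions (Suc m)"
    proof (rule antisym)
      show "?f ` ?S \<subseteq> set_partitions (Suc m)"
      proof clarsimp
        fix D Q assume a: "D \<subseteq> {Suc 0..m}" "partition_on D Q"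
        have "partition_on {1..Suc m} (insert (insert ?x ({1..m} - D)) Q)"
        proof (subst partition_on_insert)
          show "disjnt (insert ?x ({1..m} - D)) (\<Union>Q)"
            using a by (auto simp: partition_on_def disjnt_def)
          have "{1..Suc m} - insert ?x ({1..m} - D) = D" using a by (auto simp: subset_iff)
          then show "partition_on ({1..Suc m} - insert ?x ({1..m} - D)) Q \<and>
            insert ?x ({1..m} - D) \<subseteq> {1..Suc m} \<and> insert ?x ({1..m} - D) \<noteq> {}"
            using a by auto
        qed
        then show "insert (insert ?x ({Suc 0..m} - D)) Q \<in> set_partitions (Suc m)"
          by (simp add: set_partitions_def)
      qed
      show "set_partitions (Suc m) \<subseteq> ?f ` ?S"
      proof
        fix P assume P: "P \<in> set_partitions (Suc m)"
        then have p: "partition_on {1..Suc m} P" by (simp add: set_partitions_def)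
        then have "?x \<in> \<Union>P" by (simp add: partition_on_def)
        then obtain b where b: "b \<in> P" "?x \<in> b" by blast
        have bsub: "b \<subseteq> {1..Suc m}" using p b by (auto simp: partition_on_def)
        define D where "D = {1..Suc m} - b"
        have D: "D \<subseteq> ?A" using b bsub by (auto simp: D_def le_Suc_eq)
        have bD: "b = insert ?x (?A - D)"
          using b bsub by (auto simp: D_def le_Suc_eq)
        have "partition_on D (P - {b})"
          using partition_on_Diff[OF p, of "{b}"] b by (simp add: D_def)
        then have "(D, P - {b}) \<in> ?S" using D by auto
        moreover have "?f (D, P - {b}) = P" using b bD by auto
        ultimately show "P \<in> ?f ` ?S" by (metis (no_types, lifting) image_eqI)
      qed
    qed
  qed
  then have "Bell (Suc m) = card ?S" unfolding Bell_def by (rule bij_betw_same_card[symmetric])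
  also have "\<dots> = (\<Sum>D\<in>Pow ?A. card {Q. partition_on D Q})"
    by (rule card_SigmaI) (auto simp: finite_subset intro!: finitely_many_partition_on)
  also have "\<dots> = (\<Sum>D\<in>Pow ?A. Bell (card D))"
    by (rule sum.cong) (auto intro!: card_partition_on simp: finite_subset)
  also have "\<dots> = (\<Sum>k\<le>m. card {D \<in> Pow ?A. card D = k} * Bell k)"
    by (rule sum_by_card) simp
  also have "\<dots> = (\<Sum>k\<le>m. (m choose k) * Bell k)"
    using n_subsets[of ?A] by (simp add: Pow_def)
  finally show ?thesis .
qed

lemma Bell_pos: "Bell m > 0"
  using partition_on_singletons[of "{1..m}"] unfolding Bell_def card_gt_0_iff set_partitions_def
  by (auto simp: finitely_many_partition_on)

text \<open>In the recurrence the term \<open>k = m\<close> contributes \<open>Bell m\<close> once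
  and the other terms at most \<open>m\<close> times, by
  \<open>(m choose k) \<le> m * ((m - 1) choose k)\<close> for \<open>k < m\<close>. Two
  applications bound \<open>Bell m\<close> by a multiple of \<open>Bell (m - 2)\<close>.\<close>

lemma Bell_Suc_le: "Bell (Suc m) \<le> Suc m * Bell m"
proof (cases m)
  case 0
  then show ?thesis by (simp add: Bell_Suc)
next
  case (Suc j)
  have "(Suc j choose k) \<le> Suc j * (j choose k)" if "k \<le> j" for k
  proof -
    have "(Suc j choose k) * (Suc j - k) = Suc j * (j choose k)"
      using that binomial_absorb_comp[of "Suc j" k] by (simp add: mult.commute)
    moreover have "Suc j - k \<ge> 1" using that by simp
    ultimately show ?thesis by (metis mult.right_neutral mult_le_mono2)
  qed
  then have "(\<Sum>k\<le>j. (Suc j choose k) * Bell k) \<le> (\<Sum>k\<le>j. Suc j * ((j choose k) * Bell k))"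
    by (intro sum_mono) (metis mult.assoc mult_le_mono1 atMost_iff)
  also have "\<dots> = Suc j * Bell (Suc j)" by (simp add: Bell_Suc sum_distrib_left)
  finally show ?thesis using Suc by (simp add: Bell_Suc[of "Suc j"])
qed

lemma bell0_1: "bell0 (Suc 0) = 0"
proof -
  have *: "sing P \<noteq> {}" if "partition_on {1} P" for P :: "nat set set"
  proof -
    have U: "\<Union>P = {1}" and ne: "{} \<notin> P" using that by (auto simp: partition_on_def)
    then obtain p where p: "p \<in> P" "1 \<in> p" by blast
    then have "p = {1}" using U by blast
    then show ?thesis using p by auto
  qed
  have "{P \<in> set_partitions 1. sing P = {}} = {}"
    using * by (simp only: set_partitions_def atLeastAtMost_singleton) blast
  then show "bell0 (Suc 0) = 0"
    by (simp add: bell0_def)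
qed

text \<open>The new point joins the block of \<open>1\<close>; this creates no singleton and can be
  undone. The step from \<open>0\<close> to \<open>1\<close> fails, as \<open>bell0 0 = 1\<close>
  and \<open>bell0 1 = 0\<close>.\<close>

lemma bell0_Suc_ge:
  assumes "m \<ge> 1"
  shows "bell0 m \<le> bell0 (Suc m)"
proof -
  let ?x = "Suc m"
  let ?f = "\<lambda>P. (\<lambda>p. if 1 \<in> p then insert ?x p else p) ` P"
  have nx: "?x \<notin> p" if "P \<in> set_partitions m" "p \<in> P" for p P
    using set_partitions_block_subset[OF that] by auto
  have "inj_on ?f (set_partitions m)"
  proof (rule inj_on_inverseI[where g = "\<lambda>P. (\<lambda>p. p - {?x}) ` P"])
    fix P assume P: "P \<in> set_partitions m"
    have "(if 1 \<in> p then insert ?x p else p) - {?x} = p" if "p \<in> P" for p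
      using nx[OF P that] by auto
    then show "(\<lambda>p. p - {?x}) ` ?f P = P" by (simp only: image_image) simp
  qed
  then have inj: "inj_on ?f {P \<in> set_partitions m. sing P = {}}" by (rule inj_on_subset) auto
  have "?f P \<in> {P \<in> set_partitions (Suc m). sing P = {}}" if "P \<in> set_partitions m" "sing P = {}" for P
  proof -
    have p: "partition_on {1..m} P" using that by (simp add: set_partitions_def)
    have "1 \<in> \<Union>P" using p assms by (simp add: partition_on_def)
    then obtain b where b: "b \<in> P" "1 \<in> b" by blast
    have q: "(\<lambda>p. if 1 \<in> p then insert ?x p else p) p = (if p = b then insert ?x b else p)" if "p \<in> P" for p
    proof -
      have "1 \<in> p \<longleftrightarrow> p = b" using partition_on_block_eq[OF p that b(1) _ b(2)] b(2) by blast
      then show ?thesis by simp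
    qed
    have fP: "?f P = insert (insert ?x b) (P - {b})"
    proof -
      have "?f P = (\<lambda>p. if p = b then insert ?x b else p) ` P" by (rule image_cong[OF refl q])
      then show ?thesis using b(1) by auto
    qed
    have bsub: "b \<subseteq> {1..m}" using p b by (auto simp: partition_on_def)
    have rest: "partition_on ({1..m} - b) (P - {b})" using partition_on_Diff[OF p, of "{b}"] b by simp
    then have dj: "disjnt (insert ?x b) (\<Union>(P - {b}))"
      by (auto simp: partition_on_def disjnt_def)
    note rest
    moreover have "{1..Suc m} - insert ?x b = {1..m} - b" by (auto simp: le_Suc_eq)
    ultimately have "partition_on {1..Suc m} (?f P)"
      unfolding fP partition_on_insert[OF dj] using bsub by auto
    moreover have "{y} \<notin> ?f P" for y
    proof
      assume "{y} \<in> ?f P"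
      then have "{y} = insert ?x b \<or> {y} \<in> P" unfolding fP by blast
      moreover have "{y} \<notin> P" using that(2) by auto
      ultimately have "{y} = insert ?x b" by blast
      then have "?x = 1" using b(2) by (metis insertI1 insertI2 singletonD)
      then show False using assms by simp
    qed
    ultimately show ?thesis by (auto simp: set_partitions_def)
  qed
  then have "?f ` {P \<in> set_partitions m. sing P = {}} \<subseteq> {P \<in> set_partitions (Suc m). sing P = {}}" by blast
  then show ?thesis unfolding bell0_def by (rule card_inj_on_le[OF inj]) simp
qed

lemma bell0_mono:
  assumes "1 \<le> a" "a \<le> b"
  shows "bell0 a \<le> bell0 b"
  using assms(2)
proof (induction rule: dec_induct)
  case (step i)
  then show ?case using bell0_Suc_ge[of i] assms(1) by simp
qed simp

text \<open>Adding the singleton \<open>{m + 1}\<close> and merging all singletons with \<open>m + 2\<close> destroys them reversibly.\<close>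

lemma Bell_le_bell0: "Bell m \<le> bell0 (m + 2)"
proof -
  let ?y = "Suc m" and ?z = "Suc (Suc m)"
  \<comment> \<open>\<open>?y\<close> keeps the merged block from being the singleton of
    \<open>?z\<close> when \<open>sing P\<close> is empty; \<open>?g\<close> recognizes the merged
    block by \<open>?z\<close>.\<close>
  let ?f = "\<lambda>P. insert ({?y, ?z} \<union> sing P) (P - (\<lambda>x. {x}) ` sing P)"
  let ?g = "\<lambda>P. {p \<in> P. ?z \<notin> p} \<union> (\<lambda>x. {x}) ` (\<Union>{p \<in> P. ?z \<in> p} - {?y, ?z})"
  have ny: "?y \<notin> p" "?z \<notin> p" if "P \<in> set_partitions m" "p \<in> P" for p P
    using set_partitions_block_subset[OF that] by auto
  have sub: "sing P \<subseteq> {1..m}" if "P \<in> set_partitions m" for P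
    using that sing_subset by (auto simp: set_partitions_def)
  have inj: "inj_on ?f (set_partitions m)"
  proof (rule inj_on_inverseI[where g = ?g])
    fix P assume P: "P \<in> set_partitions m"
    have "{p \<in> ?f P. ?z \<notin> p} = P - (\<lambda>x. {x}) ` sing P"
      using ny[OF P] by auto
    moreover have "{p \<in> ?f P. ?z \<in> p} = {{?y, ?z} \<union> sing P}"
      using ny[OF P] by auto
    moreover have "{?y, ?z} \<union> sing P - {?y, ?z} = sing P" using sub[OF P] by auto
    ultimately have "?g (?f P) = P - (\<lambda>x. {x}) ` sing P \<union> (\<lambda>x. {x}) ` sing P" by (simp del: in_sing)
    moreover have "(\<lambda>x. {x}) ` sing P \<subseteq> P" by auto
    ultimately show "?g (?f P) = P" by (simp del: in_sing add: Un_absorb2)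
  qed
  have "?f P \<in> {P \<in> set_partitions (m + 2). sing P = {}}" if P: "P \<in> set_partitions m" for P
  proof -
    have p: "partition_on {1..m} P" using that by (simp add: set_partitions_def)
    let ?Q = "P - (\<lambda>x. {x}) ` sing P"
    have rest: "partition_on ({1..m} - sing P) ?Q"
      using partition_on_Diff[OF p, of "(\<lambda>x. {x}) ` sing P"] by (simp add: image_subset_iff)
    then have U: "\<Union>?Q = {1..m} - sing P" by (simp add: partition_on_def)
    have dj: "disjnt ({?y, ?z} \<union> sing P) (\<Union>?Q)"
      unfolding U by (auto simp: disjnt_def)
    have "{1..m + 2} - ({?y, ?z} \<union> sing P) = {1..m} - sing P" by auto
    with rest have "partition_on {1..m + 2} (?f P)"
      unfolding partition_on_insert[OF dj] using sub[OF P] by auto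
    moreover have "{x} \<notin> ?f P" for x
    proof
      assume "{x} \<in> ?f P"
      then have "{x} = {?y, ?z} \<union> sing P \<or> ({x} \<in> P \<and> {x} \<notin> (\<lambda>x. {x}) ` sing P)" by blast
      then have "{x} = {?y, ?z} \<union> sing P" by auto
      then have "?y = ?z" by (metis UnCI insertI1 insertI2 singletonD)
      then show False by simp
    qed
    ultimately show ?thesis by (auto simp: set_partitions_def)
  qed
  then have "?f ` set_partitions m \<subseteq> {P \<in> set_partitions (m + 2). sing P = {}}" by blast
  then show ?thesis unfolding bell0_def Bell_def by (rule card_inj_on_le[OF inj]) simp
qed

section \<open>Compression and shifting\<close>

text \<open>An element moves only if its image is not yet a member. So no two elements collide and
  the size is kept as soon as \<open>f\<close> is injective on the elements that it changes. Both
  the shifting of sets and the splitting of partitions are instances.\<close>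

definition compress :: "('a \<Rightarrow> 'a) \<Rightarrow> 'a set \<Rightarrow> 'a set" where
  "compress f G = (\<lambda>x. if f x \<in> G then x else f x) ` G"

lemma inj_on_compress:
  assumes "inj_on f {x \<in> G. f x \<noteq> x}"
  shows "inj_on (\<lambda>x. if f x \<in> G then x else f x) G"
proof (rule inj_onI)
  fix x y assume xy: "x \<in> G" "y \<in> G" "(if f x \<in> G then x else f x) = (if f y \<in> G then y else f y)"
  show "x = y"
  proof (cases "f x \<in> G \<or> f y \<in> G")
    case False
    then have "x \<in> {x \<in> G. f x \<noteq> x}" "y \<in> {x \<in> G. f x \<noteq> x}" using xy by auto
    then show ?thesis using assms False xy(3) by (auto dest: inj_onD)
  qed (use xy in \<open>auto split: if_splits\<close>)
qed

lemma card_compress: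
  assumes "inj_on f {x \<in> G. f x \<noteq> x}"
  shows "card (compress f G) = card G"
  unfolding compress_def by (rule card_image[OF inj_on_compress[OF assms]])

lemma card_compress_level:
  assumes "inj_on f {x \<in> G. f x \<noteq> x}" and "\<And>x. x \<in> G \<Longrightarrow> c (f x) = c x"
  shows "card {x \<in> compress f G. c x = k} = card {x \<in> G. c x = k}"
proof -
  have "{x \<in> compress f G. c x = k} = (\<lambda>x. if f x \<in> G then x else f x) ` {x \<in> G. c x = k}"
    using assms(2) by (force simp: compress_def)
  then show ?thesis
    using card_image[OF inj_on_subset[OF inj_on_compress[OF assms(1)]], of "{x \<in> G. c x = k}"]
    by (simp del: if_image_distrib)
qed

text \<open>If \<open>a\<close> moves and \<open>b\<close> stays, then \<open>b\<close> stays
  because \<open>f b\<close> is a member, so \<open>R a (f b)\<close> is available besides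
  \<open>R a b\<close>. This is why \<open>one\<close> may assume a relation with
  \<open>f y\<close>, while \<open>both\<close> may not.\<close>

lemma compress_rel:
  assumes "\<And>x y. x \<in> G \<Longrightarrow> y \<in> G \<Longrightarrow> R x y"
    and sym: "\<And>x y. R x y \<Longrightarrow> R y x"
    and one: "\<And>x y. x \<in> G \<Longrightarrow> y \<in> G \<Longrightarrow> f x \<noteq> x \<Longrightarrow> R x y \<Longrightarrow> R x (f y) \<Longrightarrow> R (f x) y"
    and both: "\<And>x y. x \<in> G \<Longrightarrow> y \<in> G \<Longrightarrow> f x \<noteq> x \<Longrightarrow> f y \<noteq> y \<Longrightarrow> R x y \<Longrightarrow> R (f x) (f y)"
    and "x \<in> compress f G" "y \<in> compress f G"
  shows "R x y"
proof -
  obtain a where a: "a \<in> G" "x = (if f a \<in> G then a else f a)" using assms(5) by (auto simp: compress_def)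
  obtain b where b: "b \<in> G" "y = (if f b \<in> G then b else f b)" using assms(6) by (auto simp: compress_def)
  have ne: "f z \<noteq> z" if "z \<in> G" "f z \<notin> G" for z using that by auto
  show ?thesis
  proof (cases "f a \<in> G"; cases "f b \<in> G")
    assume "f a \<in> G" "f b \<in> G"
    then show ?thesis using a b assms(1) by simp
  next
    assume c: "f a \<notin> G" "f b \<in> G"
    then have "R (f a) b" using one[of a b] a(1) b(1) assms(1) ne by blast
    then show ?thesis using a b c by simp
  next
    assume c: "f a \<in> G" "f b \<notin> G"
    then have "R (f b) a" using one[of b a] a(1) b(1) assms(1) ne by blast
    then show ?thesis using a b c sym by simp
  next
    assume c: "f a \<notin> G" "f b \<notin> G"
    then have "R (f a) (f b)" using both[of a b] a(1) b(1) assms(1) ne by blast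
    then show ?thesis using a b c by simp
  qed
qed

text \<open>Each compression that changes the family lowers the total of \<open>h\<close>, so the
  process stops at a family stable under all of \<open>Fs\<close>. The invariant \<open>I\<close> is
  left open because sets and partitions have different properties to carry along.\<close>

lemma compress_fixpoint:
  fixes h :: "'a \<Rightarrow> nat"
  assumes "finite U" "G \<subseteq> U" "I G"
    and step: "\<And>f G. f \<in> Fs \<Longrightarrow> G \<subseteq> U \<Longrightarrow> I G \<Longrightarrow> I (compress f G)"
    and closed: "\<And>f x. f \<in> Fs \<Longrightarrow> x \<in> U \<Longrightarrow> f x \<in> U"
    and inj: "\<And>f. f \<in> Fs \<Longrightarrow> inj_on f {x \<in> U. f x \<noteq> x}"
    and decr: "\<And>f x. f \<in> Fs \<Longrightarrow> x \<in> U \<Longrightarrow> f x \<noteq> x \<Longrightarrow> h (f x) < h x"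
  shows "\<exists>G'\<subseteq>U. I G' \<and> (\<forall>f\<in>Fs. f ` G' \<subseteq> G')"
  using assms(2,3)
proof (induction "sum h G" arbitrary: G rule: less_induct)
  case less
  show ?case
  proof (cases "\<forall>f\<in>Fs. f ` G \<subseteq> G")
    case False
    then obtain f x where f: "f \<in> Fs" "x \<in> G" "f x \<notin> G" by blast
    have fin: "finite G" using less.prems(1) assms(1) finite_subset by blast
    have inj': "inj_on f {x \<in> G. f x \<noteq> x}" using inj[OF f(1)] by (rule inj_on_subset) (use less.prems in auto)
    have le: "h (if f y \<in> G then y else f y) \<le> h y" if "y \<in> G" for y
    proof (cases "f y \<in> G")
      case False
      then have "f y \<noteq> y" using that by auto
      then show ?thesis using decr[OF f(1), of y] that less.prems(1) by auto
    qed auto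
    have "sum h (compress f G) = (\<Sum>y\<in>G. h (if f y \<in> G then y else f y))"
      unfolding compress_def by (rule sum.reindex_cong[OF inj_on_compress[OF inj']]) auto
    also have "\<dots> < sum h G"
    proof (rule sum_strict_mono_ex1[OF fin])
      show "\<forall>y\<in>G. h (if f y \<in> G then y else f y) \<le> h y" using le by blast
      have "f x \<noteq> x" using f by auto
      then have "h (f x) < h x" using decr[OF f(1), of x] f less.prems(1) by auto
      then show "\<exists>y\<in>G. h (if f y \<in> G then y else f y) < h y" using f by auto
    qed
    finally have "sum h (compress f G) < sum h G" .
    moreover have "compress f G \<subseteq> U" using closed[OF f(1)] less.prems(1) by (auto simp: compress_def)
    moreover have "I (compress f G)" using step f less.prems by blast
    ultimately show ?thesis using less.hyps by blast
  qed (use less.prems in blast)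
qed

text \<open>\<open>S = T\<close> is included, so each member has at least \<open>t\<close> elements.
  For families of partitions only distinct members are compared.\<close>

definition intersecting :: "nat \<Rightarrow> 'a set set \<Rightarrow> bool" where
  "intersecting t G \<longleftrightarrow> (\<forall>S\<in>G. \<forall>T\<in>G. t \<le> card (S \<inter> T))"

definition shift :: "nat \<Rightarrow> nat \<Rightarrow> nat set \<Rightarrow> nat set" where
  "shift i j S = (if j \<in> S \<and> i \<notin> S then insert i (S - {j}) else S)"

text \<open>\<open>j\<close> has no upper bound: in a family on \<open>{1..n}\<close> a larger
  \<open>j\<close> lies in no member, so its shifts change nothing. Thus the notion does not mention
  \<open>n\<close>, which suits an induction on \<open>n\<close>.\<close>

definition shifted :: "nat set set \<Rightarrow> bool" where
  "shifted G \<longleftrightarrow> (\<forall>i j. 1 \<le> i \<longrightarrow> i < j \<longrightarrow> shift i j ` G \<subseteq> G)"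

lemma intersectingD: "intersecting t G \<Longrightarrow> S \<in> G \<Longrightarrow> T \<in> G \<Longrightarrow> t \<le> card (S \<inter> T)"
  by (simp add: intersecting_def)

lemma shiftedD:
  "shifted G \<Longrightarrow> S \<in> G \<Longrightarrow> 1 \<le> i \<Longrightarrow> i < j \<Longrightarrow> j \<in> S \<Longrightarrow> i \<notin> S \<Longrightarrow> insert i (S - {j}) \<in> G"
  unfolding shifted_def shift_def by (auto simp: image_subset_iff)

lemma inj_on_shift: "inj_on (shift i j) {S \<in> U. shift i j S \<noteq> S}"
proof (rule inj_on_inverseI[where g = "\<lambda>S. insert j (S - {i})"])
  fix S assume "S \<in> {S \<in> U. shift i j S \<noteq> S}"
  then have "j \<in> S" "i \<notin> S" by (auto simp: shift_def split: if_splits)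
  then show "insert j (shift i j S - {i}) = S" by (auto simp: shift_def)
qed

lemma card_shift: "finite S \<Longrightarrow> card (shift i j S) = card S"
  using card.remove[of S j] by (auto simp: shift_def)

text \<open>If only \<open>S\<close> moves and \<open>i\<close> lies in \<open>T\<close>, the common
  point \<open>j\<close> that may be lost is replaced by \<open>i\<close>; if \<open>i\<close> is
  not in \<open>T\<close>, then \<open>shift i j S\<close> meets \<open>T\<close> in the same set as
  \<open>S\<close> meets \<open>shift i j T\<close>. If both move, the intersection is itself
  shifted.\<close>

lemma intersecting_compress_shift:
  assumes G: "intersecting t G" and fin: "\<And>S. S \<in> G \<Longrightarrow> finite S" and "i \<noteq> j"
  shows "intersecting t (compress (shift i j) G)"
proof -
  have one: "t \<le> card (shift i j S \<inter> T)"
    if "S \<in> G" "shift i j S \<noteq> S" "t \<le> card (S \<inter> T)" "t \<le> card (S \<inter> shift i j T)" for S T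
  proof -
    have S: "j \<in> S" "i \<notin> S" "shift i j S = insert i (S - {j})"
      using that(2) by (auto simp: shift_def split: if_splits)
    have fS: "finite S" using fin that by auto
    show ?thesis
    proof (cases "i \<in> T")
      case True
      then have "shift i j S \<inter> T = insert i (S \<inter> T - {j})" unfolding S(3) by auto
      moreover have "card (S \<inter> T) \<le> Suc (card (S \<inter> T - {j}))"
        by (metis Suc_leI card.remove card_Diff_singleton_if finite_Int fS le_SucI le_refl Diff_empty Diff_insert0)
      ultimately show ?thesis using that(3) fS S(2) by simp
    next
      case False
      then have "shift i j S \<inter> T = S \<inter> shift i j T" using S by (auto simp: shift_def)
      then show ?thesis using that(4) by simp
    qed
  qed
  have both: "t \<le> card (shift i j S \<inter> shift i j T)"
    if "S \<in> G" "shift i j S \<noteq> S" "shift i j T \<noteq> T" "t \<le> card (S \<inter> T)" for S T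
  proof -
    have S: "j \<in> S" "i \<notin> S" "shift i j S = insert i (S - {j})"
      using that(2) by (auto simp: shift_def split: if_splits)
    have T: "j \<in> T" "i \<notin> T" "shift i j T = insert i (T - {j})"
      using that(3) by (auto simp: shift_def split: if_splits)
    have "shift i j S \<inter> shift i j T = shift i j (S \<inter> T)" using S T by (auto simp: shift_def)
    then show ?thesis using that fin[of S] by (simp add: card_shift)
  qed
  show ?thesis
    unfolding intersecting_def
  proof (intro ballI)
    fix S T assume ST: "S \<in> compress (shift i j) G" "T \<in> compress (shift i j) G"
    show "t \<le> card (S \<inter> T)"
    proof (rule compress_rel[where R = "\<lambda>S T. t \<le> card (S \<inter> T)", OF _ _ _ _ ST])
      show "t \<le> card (A \<inter> B) \<Longrightarrow> t \<le> card (B \<inter> A)" for A B :: "nat set"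
        by (simp add: Int_commute)
      show "t \<le> card (A \<inter> B)" if "A \<in> G" "B \<in> G" for A B using G that by (rule intersectingD)
      show "t \<le> card (shift i j A \<inter> B)"
        if "A \<in> G" "B \<in> G" "shift i j A \<noteq> A" "t \<le> card (A \<inter> B)" "t \<le> card (A \<inter> shift i j B)" for A B
        using that(1,3-5) by (rule one)
      show "t \<le> card (shift i j A \<inter> shift i j B)"
        if "A \<in> G" "B \<in> G" "shift i j A \<noteq> A" "shift i j B \<noteq> B" "t \<le> card (A \<inter> B)" for A B
        using that(1,3-5) by (rule both)
    qed
  qed
qed

text \<open>The level sizes are what must survive, since they determine the weighted count. The sum
  of the elements decreases with every proper shift and serves as potential.\<close>

lemma shifted_family_exists:
  assumes "G \<subseteq> Pow {1..n}" "intersecting t G"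
  obtains G' where "G' \<subseteq> Pow {1..n}" "intersecting t G'" "shifted G'"
    "\<And>k. card {S \<in> G'. card S = k} = card {S \<in> G. card S = k}"
proof -
  define I where "I H \<longleftrightarrow> intersecting t H \<and> (\<forall>k. card {S \<in> H. card S = k} = card {S \<in> G. card S = k})"
    for H :: "nat set set"
  have "\<exists>G'\<subseteq>Pow {1..n}. I G' \<and> (\<forall>f\<in>{shift i j | i j. 1 \<le> i \<and> i < j}. f ` G' \<subseteq> G')"
  proof (rule compress_fixpoint[where h = "\<lambda>S. \<Sum>S"])
    show "I G" using assms(2) by (simp add: I_def)
    fix f :: "nat set \<Rightarrow> nat set" assume "f \<in> {shift i j | i j. 1 \<le> i \<and> i < j}"
    then obtain i j where f: "f = shift i j" "1 \<le> i" "i < j" by blast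
    show "inj_on f {x \<in> Pow {1..n}. f x \<noteq> x}" unfolding f(1) by (rule inj_on_shift)
    show "f S \<in> Pow {1..n}" if "S \<in> Pow {1..n}" for S
      using that f by (auto simp: shift_def subset_iff)
    show "I (compress f H)" if "H \<subseteq> Pow {1..n}" "I H" for H
    proof -
      have fin: "finite S" if "S \<in> H" for S using that \<open>H \<subseteq> Pow {1..n}\<close> finite_subset by blast
      have "intersecting t (compress f H)"
        unfolding f(1) by (rule intersecting_compress_shift) (use that f fin in \<open>auto simp: I_def\<close>)
      moreover have "card {S \<in> compress f H. card S = k} = card {S \<in> H. card S = k}" for k
        unfolding f(1) by (rule card_compress_level) (auto simp: inj_on_shift card_shift fin)
      ultimately show ?thesis using that(2) by (simp add: I_def)
    qed
    show "\<Sum>(f S) < \<Sum>S" if "S \<in> Pow {1..n}" "f S \<noteq> S" for S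
    proof -
      have S: "j \<in> S" "i \<notin> S" "f S = insert i (S - {j})"
        using that(2) f(1) by (auto simp: shift_def split: if_splits)
      have fS: "finite S" using that finite_subset by blast
      have "\<Sum>S = j + \<Sum>(S - {j})" using sum.remove[OF fS S(1), of "\<lambda>x. x"] by simp
      moreover have "\<Sum>(f S) = i + \<Sum>(S - {j})" unfolding S(3) using fS S(2) by simp
      ultimately show ?thesis using f(3) by simp
    qed
  qed (use assms in auto)
  then obtain G' where G': "G' \<subseteq> Pow {1..n}" "I G'" "\<forall>f\<in>{shift i j | i j. 1 \<le> i \<and> i < j}. f ` G' \<subseteq> G'"
    by blast
  then have "shifted G'" unfolding shifted_def by blast
  then show thesis using that[of G'] G' by (simp add: I_def)
qed

section \<open>Prefixes of the members of shifted families\<close>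

lemma card_Int_atMost_Suc:
  "card (S \<inter> {1..Suc j}) = card (S \<inter> {1..j}) + (if Suc j \<in> S then 1 else 0)"
proof -
  have "S \<inter> {1..Suc j} = (if Suc j \<in> S then insert (Suc j) (S \<inter> {1..j}) else S \<inter> {1..j})"
    by (auto simp: le_Suc_eq)
  then show ?thesis by simp
qed

text \<open>Take a counterexample \<open>T\<close> with least element sum. Exchanging a common point
  of \<open>S\<close> and \<open>T\<close> for a smaller point in neither yields a member
  \<open>T'\<close> with smaller sum, and a good prefix for \<open>T'\<close> is impossible or
  already good for \<open>T\<close>.\<close>

lemma shifted_pair_prefix:
  assumes "shifted G" "intersecting t G" "G \<subseteq> Pow {1..n}" "t \<ge> 1" "S \<in> G" "T \<in> G"
  shows "\<exists>j\<le>n. j + t \<le> card (S \<inter> {1..j}) + card (T \<inter> {1..j})"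
  using assms(6)
proof (induction "\<Sum>T" arbitrary: T rule: less_induct)
  case less
  show ?case
  proof (rule ccontr)
    assume "\<not> ?thesis"
    then have neg: "card (S \<inter> {1..j}) + card (T \<inter> {1..j}) < j + t" if "j \<le> n" for j
      using that by (meson not_less)
    have sub: "S \<subseteq> {1..n}" "T \<subseteq> {1..n}" using assms(3,5) less.prems by auto
    then have fT: "finite T" using finite_subset by blast
    have sumcard: "card (A \<inter> {1..j}) + card (B \<inter> {1..j}) = card ((A \<union> B) \<inter> {1..j}) + card (A \<inter> B \<inter> {1..j})"
      for A B :: "nat set" and j
    proof -
      have "(A \<inter> {1..j}) \<union> (B \<inter> {1..j}) = (A \<union> B) \<inter> {1..j}"
        "(A \<inter> {1..j}) \<inter> (B \<inter> {1..j}) = A \<inter> B \<inter> {1..j}" by auto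
      then show ?thesis using card_Un_Int[of "A \<inter> {1..j}" "B \<inter> {1..j}"] by simp
    qed
    \<comment> \<open>\<open>x\<close> is the \<open>t\<close>-th common element of \<open>S\<close>
      and \<open>T\<close>.\<close>
    define x where "x = (LEAST x. t \<le> card (S \<inter> T \<inter> {1..x}))"
    have "S \<inter> T \<inter> {1..n} = S \<inter> T" using sub by auto
    then have ex: "t \<le> card (S \<inter> T \<inter> {1..n})" using intersectingD[OF assms(2,5) less.prems] by simp
    then have x1: "t \<le> card (S \<inter> T \<inter> {1..x})" and xn: "x \<le> n"
      unfolding x_def by (rule LeastI, rule Least_le)
    have xmin: "card (S \<inter> T \<inter> {1..j}) < t" if "j < x" for j
      using not_less_Least[of j "\<lambda>x. t \<le> card (S \<inter> T \<inter> {1..x})"] that unfolding x_def by (simp add: not_le)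
    have "x \<noteq> 0" using x1 assms(4) by (cases x) auto
    then obtain x' where x': "x = Suc x'" by (cases x) auto
    have xin: "x \<in> S \<inter> T" and xt: "card (S \<inter> T \<inter> {1..x}) = t"
      using x1 xmin[of x'] x' card_Int_atMost_Suc[of "S \<inter> T" x'] by (auto split: if_splits)
    \<comment> \<open>The prefix up to \<open>x\<close> has exactly \<open>t\<close> common points,
      so failure of the claim at \<open>x\<close> leaves a point of \<open>{1..x}\<close> uncovered
      by \<open>S \<union> T\<close>.\<close>
    have "card ((S \<union> T) \<inter> {1..x}) < x" using neg[OF xn] sumcard[of S x T] xt by simp
    then have "\<not> {1..x} \<subseteq> S \<union> T" by (metis card_atLeastAtMost diff_Suc_1 inf.absorb2 less_irrefl)
    then obtain y where y: "y \<in> {1..x}" "y \<notin> S" "y \<notin> T" by blast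
    then have yx: "y < x" using xin by (metis IntD1 atLeastAtMost_iff le_neq_implies_less)
    define T' where "T' = insert y (T - {x})"
    have T': "T' \<in> G" unfolding T'_def
      using shiftedD[OF assms(1) less.prems, of y x] y yx xin by auto
    have "\<Sum>T = x + \<Sum>(T - {x})" using sum.remove[OF fT, of x "\<lambda>x. x"] xin by simp
    moreover have "\<Sum>T' = y + \<Sum>(T - {x})" unfolding T'_def using fT y by simp
    ultimately have "\<Sum>T' < \<Sum>T" using yx by simp
    from less.hyps[OF this T'] obtain j where j: "j \<le> n" "j + t \<le> card (S \<inter> {1..j}) + card (T' \<inter> {1..j})"
      by blast
    \<comment> \<open>Before \<open>x\<close> the sets \<open>S\<close> and \<open>T'\<close> share
      the same points as \<open>S\<close> and \<open>T\<close>, which are fewer than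
      \<open>t\<close>. From \<open>x\<close> on, the prefixes of \<open>T\<close> and
      \<open>T'\<close> have equal size.\<close>
    show False
    proof (cases "j < x")
      case True
      have "S \<inter> T' \<inter> {1..j} = S \<inter> T \<inter> {1..j}" using y True by (auto simp: T'_def)
      then have "card (S \<inter> T' \<inter> {1..j}) < t" using xmin[OF True] by simp
      moreover have "card ((S \<union> T') \<inter> {1..j}) \<le> j" using card_mono[of "{1..j}" "(S \<union> T') \<inter> {1..j}"] by simp
      ultimately show False using j sumcard[of S j T'] by simp
    next
      case False
      have "T' \<inter> {1..j} = insert y (T \<inter> {1..j} - {x})" using y False by (auto simp: T'_def)
      moreover have "x \<in> T \<inter> {1..j}" using xin False \<open>x \<noteq> 0\<close> by auto
      ultimately have "card (T' \<inter> {1..j}) = card (T \<inter> {1..j})"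
        using y card.remove[of "T \<inter> {1..j}" x] by simp
      then show False using j neg[of j] by simp
    qed
  qed
qed

text \<open>Read \<open>S\<close> as a walk with steps \<open>+1\<close> at elements and \<open>-1\<close> at non-elements: it reaches height \<open>t\<close>.\<close>

lemma shifted_walk:
  assumes "shifted G" "intersecting t G" "G \<subseteq> Pow {1..n}" "t \<ge> 1" "S \<in> G"
  obtains l where "t + 2 * l \<le> n" "card (S \<inter> {1..t + 2 * l}) = t + l"
proof -
  define P where "P j \<longleftrightarrow> j + t \<le> 2 * card (S \<inter> {1..j})" for j
  obtain j0 where j0: "j0 \<le> n" "P j0"
    using shifted_pair_prefix[OF assms assms(5)] unfolding P_def by (auto simp: mult_2)
  \<comment> \<open>The pair lemma is used with both sets equal to \<open>S\<close>. At the least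
    \<open>j\<close> the inequality is an equality, because the height changes by one at each step;
    this forces \<open>j = t + 2 * l\<close>.\<close>
  define j where "j = (LEAST j. P j)"
  have j: "P j" "j \<le> n" unfolding j_def using j0 LeastI[of P j0] Least_le[of P j0] by auto
  have "j \<noteq> 0" using j(1) assms(4) by (cases j) (auto simp: P_def)
  then obtain j' where j': "j = Suc j'" by (cases j) auto
  have "\<not> P j'" using not_less_Least[of j' P] j' unfolding j_def by simp
  then have eq: "2 * card (S \<inter> {1..j}) = j + t"
    using j(1) card_Int_atMost_Suc[of S j'] unfolding P_def j' by (auto split: if_splits)
  have "card (S \<inter> {1..j}) \<le> j" using card_mono[of "{1..j}" "S \<inter> {1..j}"] by simp
  then have "t \<le> card (S \<inter> {1..j})" using eq by simp
  then obtain l where l: "card (S \<inter> {1..j}) = t + l" using le_Suc_ex by blast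
  then have "j = t + 2 * l" using eq by simp
  then show thesis using that l j(2) by auto
qed

text \<open>A set and its complement are disjoint and cannot both be members, so the complements of
  level \<open>n - k\<close> are \<open>k\<close>-sets outside \<open>G\<close>. For
  \<open>2 * k = n\<close> the level is counted twice, giving half of the binomial.\<close>

lemma intersecting_half:
  assumes G: "intersecting 1 G" "G \<subseteq> Pow {1..n}" and k: "k \<le> n"
  shows "card {S \<in> G. card S = k} + card {S \<in> G. card S = n - k} \<le> n choose k"
proof -
  let ?A = "{S \<in> G. card S = k}" and ?B = "{S \<in> G. card S = n - k}"
  let ?c = "\<lambda>S. {1..n} - S"
  have fin: "finite G" using G(2) by (rule finite_subset) simp
  have inj: "inj_on ?c ?B" using G(2) by (intro inj_onI) blast
  have "?A \<inter> ?c ` ?B = {}"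
  proof (rule ccontr)
    assume "?A \<inter> ?c ` ?B \<noteq> {}"
    then obtain S where "S \<in> G" "{1..n} - S \<in> G" by blast
    then have "1 \<le> card (S \<inter> ({1..n} - S))" using intersectingD[OF G(1)] by blast
    then show False by simp
  qed
  then have "card ?A + card ?B = card (?A \<union> ?c ` ?B)"
    using fin inj by (simp add: card_Un_disjoint card_image)
  also have "\<dots> \<le> card {S. S \<subseteq> {1..n} \<and> card S = k}"
  proof (rule card_mono)
    have "card ({1..n} - S) = k" if "S \<in> ?B" for S
    proof -
      have "S \<subseteq> {1..n}" using that G(2) by blast
      then have "card ({1..n} - S) = n - card S" by (simp add: card_Diff_subset finite_subset)
      then show ?thesis using that k by simp
    qed
    then show "?A \<union> ?c ` ?B \<subseteq> {S. S \<subseteq> {1..n} \<and> card S = k}" using G(2) by auto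
    show "finite {S. S \<subseteq> {1..n} \<and> card S = k}" by (rule finite_subset[of _ "Pow {1..n}"]) auto
  qed
  also have "\<dots> = n choose k" using n_subsets[of "{1..n}" k] by simp
  finally show ?thesis .
qed

text \<open>Split by membership of the last point and apply Pascal's rule. Shiftedness is what keeps
  the sets intersecting after the last point is removed. The induction stops at
  \<open>2 * k = Suc n\<close>, where \<open>intersecting_half\<close> gives the bound.\<close>

lemma Erdos_Ko_Rado_shifted:
  assumes "G \<subseteq> Pow {1..n}" "intersecting 1 G" "shifted G" "\<And>S. S \<in> G \<Longrightarrow> card S = k" "2 * k \<le> n" "k \<ge> 1"
  shows "card G \<le> (n - 1) choose (k - 1)"
  using assms
proof (induction n arbitrary: G k)
  case 0
  show ?case using "0.prems"(5,6) by simp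
next
  case (Suc n)
  have fin: "finite G" using Suc.prems(1) by (rule finite_subset) simp
  have finS: "finite S" if "S \<in> G" for S using that Suc.prems(1) finite_subset by blast
  show ?case
  proof (cases "2 * k = Suc n")
    case True
    have "{S \<in> G. card S = k} = G" using Suc.prems(4) by auto
    then have "2 * card G \<le> Suc n choose k"
      using intersecting_half[OF Suc.prems(2,1), of k] True by (simp add: mult_2 flip: True)
    also have "\<dots> = 2 * (n choose (k - 1))"
    proof -
      obtain k' where k': "k = Suc k'" using Suc.prems(6) by (cases k) auto
      have "n choose k = n choose k'"
        using binomial_symmetric[of k n] True k' Suc.prems(6) by auto
      then show ?thesis using k' by simp
    qed
    finally show ?thesis by simp
  next
    case False
    then have le: "2 * k \<le> n" using Suc.prems(5) by simp
    define G0 where "G0 = {S \<in> G. Suc n \<notin> S}"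
    define G1 where "G1 = (\<lambda>S. S - {Suc n}) ` {S \<in> G. Suc n \<in> S}"
    have "inj_on (\<lambda>S. S - {Suc n}) {S \<in> G. Suc n \<in> S}" by (rule inj_onI) blast
    then have "card G1 = card {S \<in> G. Suc n \<in> S}" unfolding G1_def by (rule card_image)
    moreover have "G = G0 \<union> {S \<in> G. Suc n \<in> S}" "G0 \<inter> {S \<in> G. Suc n \<in> S} = {}" by (auto simp: G0_def)
    ultimately have split: "card G = card G0 + card G1"
      using fin by (metis (no_types, lifting) card_Un_disjoint finite_Un)
    have G1mem: "insert (Suc n) S \<in> G \<and> Suc n \<notin> S" if "S \<in> G1" for S
      using that by (auto simp: G1_def insert_absorb)
    have G0sub: "G0 \<subseteq> Pow {1..n}" using Suc.prems(1) by (fastforce simp: G0_def le_Suc_eq)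
    have G1sub: "G1 \<subseteq> Pow {1..n}" using Suc.prems(1) by (fastforce simp: G1_def le_Suc_eq)
    have "card G0 \<le> (n - 1) choose (k - 1)"
    proof (rule Suc.IH[OF G0sub _ _ _ le Suc.prems(6)])
      show "intersecting 1 G0" using Suc.prems(2) by (auto simp: intersecting_def G0_def)
      show "shifted G0"
        unfolding shifted_def
      proof (intro allI impI image_subsetI)
        fix i j :: nat and S assume ij: "1 \<le> i" "i < j" and S: "S \<in> G0"
        have "shift i j S \<in> G" using Suc.prems(3) ij S by (auto simp: shifted_def G0_def)
        moreover have "S \<subseteq> {1..n}" using S G0sub by blast
        then have "Suc n \<notin> shift i j S"
          using ij by (auto simp: shift_def)
        ultimately show "shift i j S \<in> G0" by (simp add: G0_def)
      qed
      show "card S = k" if "S \<in> G0" for S using Suc.prems(4) that by (simp add: G0_def)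
    qed
    \<comment> \<open>For \<open>k = 1\<close> truncated subtraction would give
      \<open>(n - 1) choose 0 = 1\<close>, whereas the correct value is 0.\<close>
    moreover have "card G1 \<le> (if k = 1 then 0 else (n - 1) choose (k - 2))"
    proof -
      have int1: "intersecting 1 G1"
        unfolding intersecting_def
      proof (intro ballI, rule ccontr)
        fix S T assume ST: "S \<in> G1" "T \<in> G1" "\<not> 1 \<le> card (S \<inter> T)"
        let ?S = "insert (Suc n) S" and ?T = "insert (Suc n) T"
        have mem: "?S \<in> G" "?T \<in> G" "Suc n \<notin> S" "Suc n \<notin> T" using G1mem ST by auto
        then have fST: "finite S" "finite T" using finS[of ?S] finS[of ?T] by auto
        then have disj: "S \<inter> T = {}" using ST(3) by (simp add: not_le)
        have "card ?S = k" "card ?T = k" using Suc.prems(4) mem by auto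
        then have "card (S \<union> T) < n" using le fST mem card_Un_le[of S T] by auto
        \<comment> \<open>If \<open>S\<close> and \<open>T\<close> are disjoint, they have
          \<open>2 * (k - 1) < n\<close> points in all, so a free \<open>x\<close> exists; shifting
          \<open>Suc n\<close> to \<open>x\<close> in one of the two sets makes two members
          disjoint.\<close>
        then have "\<not> {1..n} \<subseteq> S \<union> T" using card_mono[of "S \<union> T" "{1..n}"] fST by auto
        then obtain x where x: "x \<in> {1..n}" "x \<notin> S" "x \<notin> T" by blast
        have "insert x (?S - {Suc n}) \<in> G" by (rule shiftedD[OF Suc.prems(3) mem(1)]) (use x in auto)
        then have "1 \<le> card (insert x S \<inter> ?T)" using intersectingD[OF Suc.prems(2) _ mem(2)] mem(3) by simp
        moreover have "insert x S \<inter> ?T = {}" using disj x mem by auto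
        ultimately show False by simp
      qed
      have c1: "card S = k - 1" if "S \<in> G1" for S
        using G1mem[OF that] Suc.prems(4)[of "insert (Suc n) S"] finS[of "insert (Suc n) S"] by auto
      show ?thesis
      proof (cases "k = 1")
        case True
        have "S \<notin> G1" for S
        proof
          assume "S \<in> G1"
          then have "1 \<le> card (S \<inter> S)" "card S = 0" using intersectingD[OF int1, of S S] c1 True by auto
          then show False by simp
        qed
        then have "G1 = {}" by blast
        then show ?thesis by simp
      next
        case False
        have "card G1 \<le> (n - 1) choose (k - 1 - 1)"
        proof (rule Suc.IH[OF G1sub int1 _ c1])
          show "shifted G1"
            unfolding shifted_def
          proof (intro allI impI image_subsetI)
            fix i j :: nat and S assume ij: "1 \<le> i" "i < j" and S: "S \<in> G1"
            show "shift i j S \<in> G1"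
            proof (cases "j \<in> S \<and> i \<notin> S")
              case True
              have "S \<subseteq> {1..n}" using S G1sub by blast
              then have jn: "j \<le> n" using True by auto
              have "insert i (insert (Suc n) S - {j}) \<in> G"
                by (rule shiftedD[OF Suc.prems(3), of "insert (Suc n) S"]) (use G1mem[OF S] True ij jn in auto)
              moreover have "insert i (insert (Suc n) S - {j}) - {Suc n} = insert i (S - {j})"
                using G1mem[OF S] ij jn by auto
              ultimately have "insert i (S - {j}) \<in> G1" using jn unfolding G1_def
                by (metis (mono_tags, lifting) Diff_iff image_eqI insertCI mem_Collect_eq not_less_eq_eq singletonD order_refl)
              then show ?thesis using True by (simp add: shift_def)
            qed (use S in \<open>auto simp: shift_def\<close>)
          qed
          show "2 * (k - 1) \<le> n" "1 \<le> k - 1" using le False Suc.prems(6) by simp_all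
        qed
        then show ?thesis using False by (simp add: numeral_2_eq_2)
      qed
    qed
    moreover have "Suc n - 1 choose (k - 1) = ((n - 1) choose (k - 1)) + (if k = 1 then 0 else (n - 1) choose (k - 2))"
    proof (cases "k = 1")
      case False
      then obtain k'' where "k = Suc (Suc k'')" using Suc.prems(6) by (metis One_nat_def not_one_le_zero not0_implies_Suc)
      moreover obtain n' where "n = Suc n'" using le Suc.prems(6) by (cases n) auto
      ultimately show ?thesis by simp
    next
      case True
      then show ?thesis by simp
    qed
    ultimately show ?thesis using split by simp
  qed
qed

section \<open>Splitting points off blocks\<close>

text \<open>\<open>j\<close> marks the block that \<open>i\<close> leaves, so the map can be undone
  on every partition that it changes: put \<open>i\<close> back into the block of
  \<open>j\<close>.\<close>

definition split_off :: "'a \<Rightarrow> 'a \<Rightarrow> 'a set set \<Rightarrow> 'a set set" where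
  "split_off i j P = (if \<exists>A\<in>P. i \<in> A \<and> j \<in> A then insert {i} ((\<lambda>p. p - {i}) ` P) else P)"

definition star :: "nat \<Rightarrow> nat set \<Rightarrow> nat set set set" where
  "star n X = {P \<in> set_partitions n. \<forall>x\<in>X. {x} \<in> P}"

lemma star_eq: "star n X = {P \<in> set_partitions n. X \<subseteq> sing P}"
  by (auto simp: star_def)

lemma split_off_block:
  assumes P: "partition_on U P" and A: "A \<in> P" "i \<in> A" "j \<in> A"
  shows "split_off i j P = insert {i} (insert (A - {i}) (P - {A}))"
proof -
  have ne: "i \<notin> p" if "p \<in> P" "p \<noteq> A" for p using partition_on_block_eq[OF P that(1) A(1)] A(2) that(2) by blast
  have "(\<lambda>p. p - {i}) ` P = insert (A - {i}) ((\<lambda>p. p - {i}) ` (P - {A}))" using A(1) by blast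
  also have "(\<lambda>p. p - {i}) ` (P - {A}) = (\<lambda>p. p) ` (P - {A})"
    by (rule image_cong) (use ne in auto)
  finally have "(\<lambda>p. p - {i}) ` P = insert (A - {i}) (P - {A})" by simp
  moreover have "split_off i j P = insert {i} ((\<lambda>p. p - {i}) ` P)"
    unfolding split_off_def by (rule if_P) (use A in blast)
  ultimately show ?thesis by simp
qed

lemma split_off_unmoved: "\<not> (\<exists>A\<in>P. i \<in> A \<and> j \<in> A) \<Longrightarrow> split_off i j P = P"
  unfolding split_off_def by (rule if_not_P)

lemma split_off_moved:
  assumes "partition_on U P" "split_off i j P \<noteq> P"
  obtains A where "A \<in> P" "i \<in> A" "j \<in> A"
    "split_off i j P = insert {i} (insert (A - {i}) (P - {A}))"
proof (cases "\<exists>A\<in>P. i \<in> A \<and> j \<in> A")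
  case True
  then show thesis using that split_off_block[OF assms(1)] by blast
next
  case False
  then show thesis using split_off_unmoved[OF False] assms(2) by simp
qed

lemma partition_on_split_off:
  assumes P: "partition_on U P" and "i \<noteq> j"
  shows "partition_on U (split_off i j P)"
proof (cases "split_off i j P = P")
  case False
  then obtain A where A: "A \<in> P" "i \<in> A" "j \<in> A"
    "split_off i j P = insert {i} (insert (A - {i}) (P - {A}))"
    using split_off_moved[OF P] by blast
  have rest: "partition_on (U - A) (P - {A})" using partition_on_Diff[OF P, of "{A}"] A(1) by simp
  have AU: "A \<subseteq> U" using P A(1) by (auto simp: partition_on_def)
  have UR: "\<Union>(P - {A}) = U - A" using rest by (simp add: partition_on_def)
  have d1: "disjnt (A - {i}) (\<Union>(P - {A}))" unfolding UR by (auto simp: disjnt_def)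
  have d2: "disjnt {i} (\<Union>(insert (A - {i}) (P - {A})))"
    using UR A(2) by (auto simp: disjnt_def)
  have e: "U - {i} - (A - {i}) = U - A" using A(2) by auto
  have "partition_on (U - {i}) (insert (A - {i}) (P - {A}))"
    unfolding partition_on_insert[OF d1] e using rest AU A assms(2) by auto
  then show ?thesis unfolding A(4) partition_on_insert[OF d2] using AU A by auto
qed (use P in simp)

lemma inj_on_split_off:
  assumes "i \<noteq> j"
  shows "inj_on (split_off i j) {P \<in> {P. partition_on U P}. split_off i j P \<noteq> P}"
proof (rule inj_on_inverseI[where g = "\<lambda>P. (\<lambda>p. if j \<in> p then insert i p else p) ` (P - {{i}})"])
  fix P assume "P \<in> {P \<in> {P. partition_on U P}. split_off i j P \<noteq> P}"
  then have P: "partition_on U P" "split_off i j P \<noteq> P" by auto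
  obtain A where A: "A \<in> P" "i \<in> A" "j \<in> A"
    "split_off i j P = insert {i} (insert (A - {i}) (P - {A}))"
    using split_off_moved[OF P] by blast
  have "A - {i} \<noteq> {i}" by blast
  moreover have "{i} \<notin> P - {A}" using partition_on_block_eq[OF P(1) A(1) _ A(2), of "{i}"] by blast
  ultimately have 1: "split_off i j P - {{i}} = insert (A - {i}) (P - {A})" unfolding A(4) by blast
  have nj: "j \<notin> p" if "p \<in> P - {A}" for p
    using partition_on_block_eq[OF P(1) A(1) _ A(3), of p] that by blast
  have "(\<lambda>p. if j \<in> p then insert i p else p) ` (P - {A}) = (\<lambda>p. p) ` (P - {A})"
    by (rule image_cong) (use nj in auto)
  moreover have "insert i (A - {i}) = A" using A(2) by blast
  ultimately show "(\<lambda>p. if j \<in> p then insert i p else p) ` (split_off i j P - {{i}}) = P"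
    unfolding 1 using A assms by auto
qed

lemma t_intersecting_sym: "t_intersecting t P Q \<Longrightarrow> t_intersecting t Q P"
  by (simp add: t_intersecting_def Int_commute)

lemma t_intersecting_mono:
  assumes "t_intersecting t P Q" "P \<inter> Q \<subseteq> P' \<inter> Q'"
  shows "t_intersecting t P' Q'"
proof -
  obtain S where S: "S \<subseteq> P \<inter> Q" "finite S" "card S = t"
    using assms(1) unfolding t_intersecting_def by (elim exE conjE) (rule that)
  have "S \<subseteq> P' \<inter> Q'" using S(1) assms(2) by (rule subset_trans)
  then show ?thesis unfolding t_intersecting_def using S(2,3) by (intro exI conjI)
qed

text \<open>If \<open>Q\<close> does not move, the block \<open>A\<close> that \<open>P\<close>
  loses is no part of \<open>Q\<close>, so no common part disappears. If \<open>Q\<close> moves, the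
  common parts of \<open>P\<close> and \<open>split_off i j Q\<close> survive, because neither new
  part of the latter belongs to \<open>P\<close>. The equality alternatives reflect that only
  distinct members are compared.\<close>

lemma t_intersecting_split_off_one:
  assumes P: "partition_on U P" and Q: "partition_on U Q" and ij: "i \<noteq> j"
    and moved: "split_off i j P \<noteq> P"
    and R: "P = Q \<or> t_intersecting t P Q" "P = split_off i j Q \<or> t_intersecting t P (split_off i j Q)"
    and neq: "split_off i j P \<noteq> Q"
  shows "t_intersecting t (split_off i j P) Q"
proof -
  obtain A where A: "A \<in> P" "i \<in> A" "j \<in> A"
    "split_off i j P = insert {i} (insert (A - {i}) (P - {A}))"
    using split_off_moved[OF P moved] by blast
  show ?thesis
  proof (cases "split_off i j Q = Q")
    case True
    have "A \<notin> Q"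
    proof
      assume "A \<in> Q"
      then have "split_off i j Q = insert {i} (insert (A - {i}) (Q - {A}))"
        using split_off_block[OF Q] A by blast
      then have "{i} \<in> Q" using True by blast
      then show False using partition_on_block_eq[OF Q \<open>A \<in> Q\<close> _ A(2), of "{i}"] A(3) ij by auto
    qed
    then have "P \<noteq> Q" "P \<inter> Q \<subseteq> split_off i j P \<inter> Q" using A by auto
    then show ?thesis using R(1) t_intersecting_mono by blast
  next
    case False
    obtain B where B: "B \<in> Q" "i \<in> B" "j \<in> B"
      "split_off i j Q = insert {i} (insert (B - {i}) (Q - {B}))"
      using split_off_moved[OF Q False] by blast
    have 1: "{i} \<notin> P" using partition_on_block_eq[OF P A(1) _ A(2), of "{i}"] A(3) ij by auto
    have 2: "B - {i} \<notin> P" using partition_on_block_eq[OF P A(1) _ A(3), of "B - {i}"] A(2) B(3) ij by blast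
    have 3: "A \<notin> Q - {B}" using partition_on_block_eq[OF Q B(1) _ B(2), of A] A(2) by blast
    have 4: "A \<noteq> {i}" "A \<noteq> B - {i}" using A ij by auto
    have "P \<noteq> split_off i j Q" using 1 B(4) by blast
    moreover have "P \<inter> split_off i j Q \<subseteq> split_off i j P \<inter> Q"
      unfolding A(4) B(4) using 1 2 3 4 by blast
    ultimately show ?thesis using R(2) t_intersecting_mono by blast
  qed
qed

text \<open>The only common part that can be lost is \<open>A = B\<close>, and the new common part
  \<open>{i}\<close> replaces it.\<close>

lemma t_intersecting_split_off_both:
  assumes P: "partition_on U P" and Q: "partition_on U Q" and ij: "i \<noteq> j"
    and moved: "split_off i j P \<noteq> P" "split_off i j Q \<noteq> Q"
    and R: "t_intersecting t P Q"
  shows "t_intersecting t (split_off i j P) (split_off i j Q)"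
proof -
  obtain A where A: "A \<in> P" "i \<in> A" "j \<in> A"
    "split_off i j P = insert {i} (insert (A - {i}) (P - {A}))"
    using split_off_moved[OF P moved(1)] by blast
  obtain B where B: "B \<in> Q" "i \<in> B" "j \<in> B"
    "split_off i j Q = insert {i} (insert (B - {i}) (Q - {B}))"
    using split_off_moved[OF Q moved(2)] by blast
  obtain S where S: "S \<subseteq> P \<inter> Q" "finite S" "card S = t" using R by (auto simp: t_intersecting_def)
  show ?thesis
  proof (cases "A \<in> S")
    case False
    have "B \<notin> S"
      using partition_on_block_eq[OF P A(1) _ A(2) B(2)] S(1) False by blast
    then have "S \<subseteq> split_off i j P \<inter> split_off i j Q" unfolding A(4) B(4) using S(1) False by blast
    then show ?thesis using S by (auto simp: t_intersecting_def)
  next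
    case True
    then have AB: "A = B" using partition_on_block_eq[OF Q _ B(1) A(2) B(2)] S(1) by blast
    have "{i} \<notin> S" using partition_on_block_eq[OF P A(1) _ A(2), of "{i}"] A(3) ij S(1) by auto
    then have "card (insert {i} (S - {A})) = Suc (card (S - {A}))" using S(2) by simp
    then have "card (insert {i} (S - {A})) = t" using S(3) card.remove[OF S(2) True] by metis
    moreover have "insert {i} (S - {A}) \<subseteq> split_off i j P \<inter> split_off i j Q"
      unfolding A(4) B(4) AB using S(1) by blast
    ultimately show ?thesis using S(2) unfolding t_intersecting_def by blast
  qed
qed

section \<open>Recovering a star from its compression\<close>

lemma t_intersecting_card:
  assumes "t_intersecting t P Q" "P \<inter> Q \<subseteq> Z" "finite Z"
  shows "t \<le> card Z"
proof -
  obtain S where "S \<subseteq> P \<inter> Q" "card S = t" using assms(1) by (auto simp: t_intersecting_def)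
  then show ?thesis using card_mono[OF assms(3), of S] assms(2) by auto
qed

lemma two_le_cardD:
  assumes "2 \<le> card S"
  shows "S \<noteq> {}" "S \<noteq> {x}"
  using assms by auto

lemma insert_eq_pairD:
  assumes "insert i S = {i, j}" "i \<notin> S"
  shows "S \<subseteq> {j}"
proof
  fix x assume "x \<in> S"
  then have "x \<in> {i, j}" "x \<noteq> i" using assms by auto
  then show "x \<in> {j}" by simp
qed

lemma Diff_singleton_pair:
  assumes "B - {i} = {x}" "i \<in> B" "j \<in> B" "i \<noteq> j"
  shows "x = j" "B = {i, j}"
proof -
  have "j \<in> B - {i}" using assms(3,4) by simp
  then show "x = j" unfolding assms(1) by simp
  then show "B = {i, j}" using assms(1,2) insert_Diff[OF assms(2)] by simp
qed

lemma star_witness_block: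
  assumes "X \<subseteq> {1..n}" "X \<noteq> {1..n}"
  shows "insert ({1..n} - X) ((\<lambda>x. {x}) ` X) \<in> star n X"
proof -
  have "partition_on {1..n} (insert ({1..n} - X) ((\<lambda>x. {x}) ` X))"
  proof (subst partition_on_insert)
    have "{1..n} - ({1..n} - X) = X" using assms by blast
    then show "partition_on ({1..n} - ({1..n} - X)) ((\<lambda>x. {x}) ` X) \<and> {1..n} - X \<subseteq> {1..n} \<and> {1..n} - X \<noteq> {}"
      using partition_on_singletons[of X] assms by auto
  qed (auto simp: disjnt_def)
  then show ?thesis by (auto simp: star_def set_partitions_def)
qed

lemma star_witness_singletons: "X \<subseteq> {1..n} \<Longrightarrow> (\<lambda>x. {x}) ` {1..n} \<in> star n X"
  using partition_on_singletons[of "{1..n}"] by (auto simp: star_def set_partitions_def)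

text \<open>
  A partition \<open>P\<close> of \<open>F\<close> outside \<open>star n X\<close> is refuted by a \<open>Q \<in> F\<close> lying over either the partition
  into the singletons of \<open>X\<close> and one further block or the partition into singletons.
\<close>

lemma compress_split_off_star:
  assumes F: "F \<subseteq> set_partitions n" and R: "\<And>P Q. P \<in> F \<Longrightarrow> Q \<in> F \<Longrightarrow> P = Q \<or> t_intersecting t P Q"
    and X: "X \<subseteq> {1..n}" "card X = t" "t + 2 \<le> n" and ij: "i \<noteq> j" "i \<in> {1..n}" "j \<in> {1..n}"
    and star: "compress (split_off i j) F = star n X"
  shows "F = star n X"
proof (rule ccontr)
  assume "F \<noteq> star n X"
  let ?f = "split_off i j" and ?sg = "\<lambda>x. {x}"
  let ?R = "{1..n} - X"
  have part: "partition_on {1..n} P" if "P \<in> F" for P using that F by (auto simp: set_partitions_def)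
  have fX: "finite X" using X(1) finite_subset by blast
  \<comment> \<open>Here \<open>t + 2 \<le> n\<close> enters: the block \<open>?R\<close> of the
    first witness must not be a singleton.\<close>
  have cR: "card ?R \<ge> 2" using X fX by (simp add: card_Diff_subset)
  have "card F = card (star n X)"
    unfolding star[symmetric]
    by (rule card_compress[symmetric]) (rule inj_on_subset[OF inj_on_split_off[OF ij(1), of "{1..n}"]], use part in auto)
  then have "\<not> F \<subseteq> star n X"
    using card_subset_eq[of "star n X" F] \<open>F \<noteq> star n X\<close> by (auto simp: star_def)
  then obtain P where P: "P \<in> F" "P \<notin> star n X" by blast
  \<comment> \<open>Every partition of the star comes from a member of \<open>F\<close> that equals
    it or becomes it by splitting off \<open>i\<close>.\<close>
  have lift: "\<exists>Q\<in>F. Q = Q' \<or> (?f Q = Q' \<and> ?f Q \<noteq> Q)" if Q': "Q' \<in> star n X" for Q'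
  proof -
    obtain Q where Q: "Q \<in> F" "Q' = (if ?f Q \<in> F then Q else ?f Q)"
      using Q' unfolding star[symmetric] compress_def by blast
    then show ?thesis by (cases "?f Q \<in> F") auto
  qed
  have "(if ?f P \<in> F then P else ?f P) \<in> star n X" using P(1) unfolding star[symmetric] compress_def by blast
  then have fP: "?f P \<in> star n X" "?f P \<noteq> P" using P by (auto split: if_splits)
  obtain A where A: "A \<in> P" "i \<in> A" "j \<in> A" "?f P = insert {i} (insert (A - {i}) (P - {A}))"
    using split_off_moved[OF part[OF P(1)] fP(2)] by blast
  have blk: "p = A" if "p \<in> P" "i \<in> p \<or> j \<in> p" for p
    using that A partition_on_block_eq[OF part[OF P(1)]] by blast
  have iP: "{i} \<notin> P" using blk[of "{i}"] A(3) ij(1) by auto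
  have jP: "{j} \<notin> P" using blk[of "{j}"] A(2) ij(1) by auto
  have RX: "?R \<notin> ?sg ` X" by blast
  note neR = two_le_cardD(1)[OF cR]
  note nsR = two_le_cardD(2)[OF cR] neR
  have W1: "insert ?R (?sg ` X) \<in> star n X" using star_witness_block[OF X(1)] neR X(1) by blast
  have W2: "?sg ` {1..n} \<in> star n X" by (rule star_witness_singletons[OF X(1)])
  have contr: False if "Q \<in> F" "P \<noteq> Q" "P \<inter> Q \<subseteq> Z" "finite Z" "card Z < t" for Q Z
    using R[OF P(1) that(1)] t_intersecting_card[of t P Q Z] that by auto
  have small1: "finite (?sg ` (X - {i}))" "i \<in> X \<Longrightarrow> card (?sg ` (X - {i})) < t"
    using fX X(2) card_Diff1_less[of X i] card_image_le[of "X - {i}" ?sg] by auto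
  have small1': "finite (?sg ` (X - {j}))" "j \<in> X \<Longrightarrow> card (?sg ` (X - {j})) < t"
    using fX X(2) card_Diff1_less[of X j] card_image_le[of "X - {j}" ?sg] by auto
  \<comment> \<open>One block in place of the two singletons of \<open>i\<close> and
    \<open>j\<close> leaves at most \<open>t - 1\<close> common parts; \<open>b\<close> will be a
    block containing both points.\<close>
  have small2: "finite (insert b (?sg ` (X - {i, j})))" "i \<in> X \<Longrightarrow> j \<in> X \<Longrightarrow> card (insert b (?sg ` (X - {i, j}))) < t" for b
  proof -
    show "finite (insert b (?sg ` (X - {i, j})))" using fX by simp
    assume "i \<in> X" "j \<in> X"
    then have "card (X - {i, j}) = t - 2" "t \<ge> 2"
      using fX X(2) ij(1) card_mono[of X "{i, j}"] by (auto simp: card_Diff_subset)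
    moreover have "card (insert b (?sg ` (X - {i, j}))) \<le> Suc (card (X - {i, j}))"
      using card_insert_le_m1 card_image_le[of "X - {i, j}" ?sg] fX
      by (metis card_insert_if finite_Diff finite_imageI le_SucI not_less_eq_eq)
    ultimately show "card (insert b (?sg ` (X - {i, j}))) < t" by simp
  qed
  have merged: "\<exists>B. B \<in> Q \<and> i \<in> B \<and> B - {i} \<in> Q' \<and> j \<in> B \<and> Q - {B} \<subseteq> Q' - {{i}, B - {i}}"
    if Q: "Q \<in> F" "?f Q = Q'" and mv: "?f Q \<noteq> Q" for Q Q'
  proof -
    obtain B where B: "B \<in> Q" "i \<in> B" "j \<in> B" "?f Q = insert {i} (insert (B - {i}) (Q - {B}))"
      using split_off_moved[OF part[OF Q(1)] mv] by blast
    have "{i} \<notin> Q - {B}" using partition_on_block_eq[OF part[OF Q(1)] B(1) _ B(2), of "{i}"] by blast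
    moreover have "B - {i} \<notin> Q - {B}"
      using partition_on_block_eq[OF part[OF Q(1)] B(1) _ B(3), of "B - {i}"] B(3) ij(1) by blast
    ultimately have "Q - {B} \<subseteq> Q' - {{i}, B - {i}}" "B - {i} \<in> Q'" using B(4) Q(2) by blast+
    then show ?thesis using B by blast
  qed
  show False
  proof (cases "i \<in> X")
    case False
    \<comment> \<open>The singleton that \<open>P\<close> lacks must be the other piece of the
      split, so it is \<open>{j}\<close> and \<open>A = {i, j}\<close>. The first witness has no
      part \<open>{i}\<close>, so it did not arise by splitting and belongs to \<open>F\<close>
      itself.\<close>
    obtain x where x: "x \<in> X" "{x} \<notin> P" using P F by (auto simp: star_def)
    have "{x} \<in> ?f P" using fP(1) x(1) by (simp add: star_def)
    then have "{x} = {i} \<or> {x} = A - {i}" using x(2) unfolding A(4) by (metis DiffD1 insertE)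
    moreover have "{x} \<noteq> {i}" using False x(1) by auto
    ultimately have Ax: "A - {i} = {x}" by metis
    then have jX: "j \<in> X" and AA: "A = {i, j}"
      using x(1) Diff_singleton_pair[OF Ax A(2,3) ij(1)] by simp_all
    obtain Q where Q: "Q \<in> F" "Q = insert ?R (?sg ` X) \<or> (?f Q = insert ?R (?sg ` X) \<and> ?f Q \<noteq> Q)"
      using lift[OF W1] by blast
    have "?f Q \<noteq> insert ?R (?sg ` X)" if "?f Q \<noteq> Q"
    proof -
      have "{i} \<in> ?f Q" using split_off_moved[OF part[OF Q(1)] that] by blast
      moreover have "{i} \<notin> insert ?R (?sg ` X)" using nsR False by auto
      ultimately show ?thesis by metis
    qed
    then have Qe: "Q = insert ?R (?sg ` X)" using Q(2) by blast
    have "?R \<notin> P" using blk[of ?R] False ij(2) jX AA by blast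
    then have "P \<inter> Q \<subseteq> ?sg ` (X - {j})" using jP Qe by blast
    moreover have "P \<noteq> Q" using \<open>?R \<notin> P\<close> Qe by blast
    ultimately show False using contr[OF Q(1)] small1' jX by blast
  next
    case iX: True
    have ne2: "insert i ?R \<noteq> {i, j}" "insert i ?R \<noteq> {x}" for x
    proof -
      have "i \<notin> ?R" using iX by simp
      show "insert i ?R \<noteq> {i, j}"
      proof
        assume "insert i ?R = {i, j}"
        from insert_eq_pairD[OF this \<open>i \<notin> ?R\<close>] show False using nsR by (metis subset_singletonD)
      qed
      show "insert i ?R \<noteq> {x}"
      proof
        assume "insert i ?R = {x}"
        then have "?R \<subseteq> {x}" by (metis subset_insertI)
        then show False using nsR by (metis subset_singletonD)
      qed
    qed
    show False
    \<comment> \<open>If \<open>P\<close> contains the large block of the first witness, with or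
      without \<open>i\<close>, then no point outside \<open>X\<close> is a singleton of
      \<open>P\<close>, and comparison with the all-singleton witness succeeds. Otherwise the first
      witness shares few parts with \<open>P\<close>.\<close>
    proof (cases "?R \<in> P \<or> insert i ?R \<in> P")
      case True
      have nsing: "x \<in> X - {i}" if "{x} \<in> P" "x \<in> {1..n}" for x
      proof (rule ccontr)
        assume "x \<notin> X - {i}"
        then have "x \<in> ?R" using that iP by auto
        then have "{x} = ?R \<or> {x} = insert i ?R"
          using True partition_on_block_eq[OF part[OF P(1)] that(1), of _ x] by blast
        then show False using nsR(1)[of x] ne2(2)[of x] by metis
      qed
      obtain Q where Q: "Q \<in> F" "Q = ?sg ` {1..n} \<or> (?f Q = ?sg ` {1..n} \<and> ?f Q \<noteq> Q)"
        using lift[OF W2] by blast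
      show False
      proof (cases "Q = ?sg ` {1..n}")
        case Qe: True
        have "P \<inter> Q \<subseteq> ?sg ` (X - {i})" using nsing Qe by blast
        moreover have "P \<noteq> Q" using iP Qe ij(2) by blast
        ultimately show False using contr[OF Q(1)] small1 iX by blast
      next
        case False
        then have fQ: "?f Q = ?sg ` {1..n}" "?f Q \<noteq> Q" using Q(2) by simp_all
        obtain B where B: "B \<in> Q" "i \<in> B" "B - {i} \<in> ?sg ` {1..n}" "j \<in> B"
            "Q - {B} \<subseteq> ?sg ` {1..n} - {{i}, B - {i}}"
          using merged[OF Q(1) fQ] by (elim exE conjE) (rule that)
        obtain x where x: "B - {i} = {x}" using B(3) by blast
        have Bj: "B - {i} = {j}" and Bij: "B = {i, j}"
          using Diff_singleton_pair[OF x B(2,4) ij(1)] x by simp_all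
        have QB: "Q \<subseteq> insert B (?sg ` ({1..n} - {i, j}))" using B(5) unfolding Bj by blast
        have neq: "P \<noteq> Q"
        proof
          assume "P = Q"
          then have "?R \<in> insert B (?sg ` ({1..n} - {i, j})) \<or> insert i ?R \<in> insert B (?sg ` ({1..n} - {i, j}))"
            using True QB by blast
          moreover have "?R \<noteq> B" using iX B(2) by blast
          moreover have "?R \<notin> ?sg ` S" "insert i ?R \<notin> ?sg ` S" for S using nsR ne2 by auto
          ultimately show False using ne2 Bij by blast
        qed
        show False
        proof (cases "B \<in> P")
          case BP: True
          have "insert i ?R \<notin> P"
            using partition_on_block_eq[OF part[OF P(1)] BP _ B(2), of "insert i ?R"] Bij ne2(1) by auto
          then have "?R \<in> P" using True by blast
          moreover have "?R \<noteq> B" using iX B(2) by blast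
          ultimately have "j \<notin> ?R" using partition_on_block_eq[OF part[OF P(1)] BP _ B(4), of ?R] by blast
          then have jX: "j \<in> X" using ij(3) by blast
          have "P \<inter> Q \<subseteq> insert B (?sg ` (X - {i, j}))" using QB nsing by blast
          then show False using contr[OF Q(1) neq _ small2(1)] small2(2) iX jX by blast
        next
          case False
          then have "P \<inter> Q \<subseteq> ?sg ` (X - {i})" using QB nsing by blast
          then show False using contr[OF Q(1) neq] small1 iX by blast
        qed
      qed
    next
      case False
      obtain Q where Q: "Q \<in> F" "Q = insert ?R (?sg ` X) \<or> (?f Q = insert ?R (?sg ` X) \<and> ?f Q \<noteq> Q)"
        using lift[OF W1] by blast
      show False
      proof (cases "Q = insert ?R (?sg ` X)")
        case True
        have "P \<inter> Q \<subseteq> ?sg ` (X - {i})" using iP False True by blast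
        moreover have "P \<noteq> Q" using False True by blast
        ultimately show False using contr[OF Q(1)] small1 iX by blast
      next
        case notQ: False
        then have fQ: "?f Q = insert ?R (?sg ` X)" "?f Q \<noteq> Q" using Q(2) by simp_all
        obtain B where B: "B \<in> Q" "i \<in> B" "B - {i} \<in> insert ?R (?sg ` X)" "j \<in> B"
            "Q - {B} \<subseteq> insert ?R (?sg ` X) - {{i}, B - {i}}"
          using merged[OF Q(1) fQ] by (elim exE conjE) (rule that)
        show False
        proof (cases "B - {i} = ?R")
          case True
          then have Be: "B = insert i ?R" using B(2) by blast
          then have "B \<notin> P" using False by blast
          then have "P \<inter> Q \<subseteq> ?sg ` (X - {i})" using B(5) True by blast
          moreover have "P \<noteq> Q" using \<open>B \<notin> P\<close> B(1) by blast
          ultimately show False using contr[OF Q(1)] small1 iX by blast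
        next
          case nR: False
          then obtain x where x: "B - {i} = {x}" "x \<in> X" using B(3) by blast
          then have Bj: "B - {i} = {j}" "j \<in> X" using x Diff_singleton_pair[OF x(1) B(2,4) ij(1)] by simp_all
          have "P \<inter> Q \<subseteq> insert B (?sg ` (X - {i, j}))"
          proof
            fix p assume p: "p \<in> P \<inter> Q"
            have "p \<in> ?sg ` (X - {i, j})" if "p \<noteq> B"
            proof -
              have "p \<in> insert ?R (?sg ` X) - {{i}, {j}}" using that p B(5) unfolding Bj(1) by auto
              moreover have "p \<noteq> ?R" using p False by auto
              ultimately show ?thesis by auto
            qed
            then show "p \<in> insert B (?sg ` (X - {i, j}))" by auto
          qed
          moreover have "P \<noteq> Q"
          proof
            assume "P = Q"
            have "?f Q = insert {i} (insert (B - {i}) (Q - {B}))"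
              using split_off_block[OF part[OF Q(1)] B(1,2,4)] .
            moreover have "?R \<in> ?f Q" using Q(2) notQ by blast
            ultimately have "?R \<in> Q" using nR nsR(1)[of i] by (metis DiffD1 insertE)
            then show False using \<open>P = Q\<close> False by blast
          qed
          ultimately show False using contr[OF Q(1) _ _ small2(1)] small2(2) iX Bj(2) by blast
        qed
      qed
    qed
  qed
qed

text \<open>Induction on the number of common parts that are not singletons: splitting a point off
  such a part in \<open>P\<close> destroys it without creating a common part, and the result is
  still in the family. A second member is needed for \<open>P = Q\<close>, where it bounds
  \<open>card (sing P)\<close> from below.\<close>

lemma stable_sing_intersecting:
  assumes F: "F \<subseteq> set_partitions n" and R: "\<And>P Q. P \<in> F \<Longrightarrow> Q \<in> F \<Longrightarrow> P = Q \<or> t_intersecting t P Q"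
    and stable: "\<And>i j. i \<in> {1..n} \<Longrightarrow> j \<in> {1..n} \<Longrightarrow> i \<noteq> j \<Longrightarrow> split_off i j ` F \<subseteq> F"
    and two: "card F \<ge> 2"
  shows "intersecting t (sing ` F)"
proof -
  have part: "partition_on {1..n} P" if "P \<in> F" for P using that F by (auto simp: set_partitions_def)
  have fins: "finite (sing P)" if "P \<in> F" for P
    using sing_subset[OF part[OF that]] finite_subset by blast
  have finP: "finite P" if "P \<in> F" for P using part[OF that] finite_elements by blast
  have ne: "t \<le> card (sing P \<inter> sing Q)" if "P \<in> F" "Q \<in> F" "P \<noteq> Q" for P Q
    using that
  proof (induction "card (P \<inter> Q - (\<lambda>x. {x}) ` UNIV)" arbitrary: P rule: less_induct)
    case less
    show ?case
    proof (cases "P \<inter> Q \<subseteq> (\<lambda>x. {x}) ` UNIV")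
      case True
      then have "P \<inter> Q \<subseteq> (\<lambda>x. {x}) ` (sing P \<inter> sing Q)" by auto
      moreover have "t_intersecting t P Q" using R less.prems by blast
      ultimately have "t \<le> card ((\<lambda>x. {x}) ` (sing P \<inter> sing Q))"
        using t_intersecting_card fins[OF less.prems(1)] by blast
      then show ?thesis using card_image_le[of "sing P \<inter> sing Q" "\<lambda>x. {x}"] fins[OF less.prems(1)] by simp
    next
      case False
      then obtain A where A: "A \<in> P" "A \<in> Q" "A \<notin> (\<lambda>x. {x}) ` UNIV" by blast
      have "A \<noteq> {}" using part[OF less.prems(1)] A(1) by (auto simp: partition_on_def)
      then obtain i where i: "i \<in> A" by blast
      then obtain j where j: "j \<in> A" "j \<noteq> i" using A(3) by blast
      have "A \<subseteq> {1..n}" using set_partitions_block_subset F less.prems(1) A(1) by blast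
      then have "split_off i j P \<in> F" using stable[of i j] i j less.prems(1) by blast
      moreover have sp: "split_off i j P = insert {i} (insert (A - {i}) (P - {A}))"
        using split_off_block[OF part[OF less.prems(1)] A(1) i j(1)] .
      have Qb: "p = A" if "p \<in> Q" "i \<in> p \<or> j \<in> p" for p
        using that A i j partition_on_block_eq[OF part[OF less.prems(2)]] by blast
      have nQ: "{i} \<notin> Q" "A - {i} \<notin> Q" "{j} \<notin> Q"
        using Qb[of "{i}"] Qb[of "A - {i}"] Qb[of "{j}"] i j by auto
      have "split_off i j P \<noteq> Q" using nQ sp by blast
      moreover have "card (split_off i j P \<inter> Q - (\<lambda>x. {x}) ` UNIV) < card (P \<inter> Q - (\<lambda>x. {x}) ` UNIV)"
      proof (rule psubset_card_mono)
        show "finite (P \<inter> Q - (\<lambda>x. {x}) ` UNIV)" using finP less.prems(1) by blast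
        have "A \<notin> split_off i j P" unfolding sp using i j(1,2) by blast
        then show "split_off i j P \<inter> Q - (\<lambda>x. {x}) ` UNIV \<subset> P \<inter> Q - (\<lambda>x. {x}) ` UNIV"
          using A nQ unfolding sp by blast
      qed
      ultimately have "t \<le> card (sing (split_off i j P) \<inter> sing Q)" using less.hyps less.prems(2) by blast
      moreover have "sing (split_off i j P) \<inter> sing Q \<subseteq> sing P \<inter> sing Q"
      proof
        fix x assume "x \<in> sing (split_off i j P) \<inter> sing Q"
        then have x: "{x} \<in> split_off i j P" "{x} \<in> Q" by auto
        then have "{x} \<in> P" using nQ(1,2) unfolding sp by (metis DiffD1 insertE)
        then show "x \<in> sing P \<inter> sing Q" using x(2) by simp
      qed
      ultimately show ?thesis using card_mono[of "sing P \<inter> sing Q"] fins[OF less.prems(1)]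
        by (meson finite_Int order_trans)
    qed
  qed
  have "t \<le> card (sing P \<inter> sing Q)" if PQ: "P \<in> F" "Q \<in> F" for P Q
  proof (cases "P = Q")
    case True
    have "F \<noteq> {P}" using two by auto
    then obtain Q' where "Q' \<in> F" "Q' \<noteq> P" using PQ(1) by blast
    then have "t \<le> card (sing P \<inter> sing Q')" using ne PQ(1) by blast
    also have "\<dots> \<le> card (sing P)" using fins[OF PQ(1)] by (intro card_mono) auto
    finally show ?thesis using True by simp
  qed (use ne PQ in blast)
  then show ?thesis by (auto simp: intersecting_def)
qed

text \<open>The potential is the number of ordered pairs of points in a common block. The invariant
  carries the last conclusion along backwards, one splitting at a time, so that equality for
  \<open>F'\<close> says something about \<open>F\<close>.\<close>

lemma compressed_partition_family_exists:
  assumes F: "F \<subseteq> set_partitions n" and t: "t_intersecting_family t F" and two: "card F \<ge> 2"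
  obtains F' where "F' \<subseteq> set_partitions n" "card F' = card F" "intersecting t (sing ` F')"
    "\<And>X. X \<subseteq> {1..n} \<Longrightarrow> card X = t \<Longrightarrow> t + 2 \<le> n \<Longrightarrow> F' = star n X \<Longrightarrow> F = star n X"
proof -
  define rel where "rel H \<longleftrightarrow> (\<forall>P\<in>H. \<forall>Q\<in>H. P = Q \<or> t_intersecting t P Q)" for H :: "nat set set set"
  define I where "I H \<longleftrightarrow> rel H \<and> card H = card F \<and>
      (\<forall>X. X \<subseteq> {1..n} \<longrightarrow> card X = t \<longrightarrow> t + 2 \<le> n \<longrightarrow> H = star n X \<longrightarrow> F = star n X)" for H
  define Fs where "Fs = {split_off i j | i j. i \<in> {1..n} \<and> j \<in> {1..n} \<and> i \<noteq> j}"
  have "\<exists>F'\<subseteq>set_partitions n. I F' \<and> (\<forall>f\<in>Fs. f ` F' \<subseteq> F')"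
  proof (rule compress_fixpoint[where h = "\<lambda>P. card (\<Union>p\<in>P. p \<times> p)"])
    show "I F" using t by (auto simp: I_def rel_def t_intersecting_family_def pairwise_def)
    fix f assume "f \<in> Fs"
    then obtain i j where f: "f = split_off i j" "i \<in> {1..n}" "j \<in> {1..n}" "i \<noteq> j" by (auto simp: Fs_def)
    show inj: "inj_on f {P \<in> set_partitions n. f P \<noteq> P}"
      using inj_on_split_off[OF f(4), of "{1..n}"] by (simp add: f(1) set_partitions_def)
    show closed: "f P \<in> set_partitions n" if "P \<in> set_partitions n" for P
      using that partition_on_split_off[OF _ f(4)] by (simp add: f(1) set_partitions_def)
    show "card (\<Union>p\<in>f P. p \<times> p) < card (\<Union>p\<in>P. p \<times> p)" if Pn: "P \<in> set_partitions n" and mv: "f P \<noteq> P" for P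
    proof (rule psubset_card_mono)
      have P: "partition_on {1..n} P" using Pn by (simp add: set_partitions_def)
      obtain A where A: "A \<in> P" "i \<in> A" "j \<in> A" "f P = insert {i} (insert (A - {i}) (P - {A}))"
        using split_off_moved[OF P mv[unfolded f(1)]] unfolding f(1) by blast
      have "(\<Union>p\<in>P. p \<times> p) \<subseteq> {1..n} \<times> {1..n}" using set_partitions_block_subset[OF Pn] by blast
      then show "finite (\<Union>p\<in>P. p \<times> p)" by (rule finite_subset) simp
      have "(i, j) \<notin> (\<Union>p\<in>f P. p \<times> p)"
        unfolding A(4) using partition_on_block_eq[OF P A(1) _ A(2)] f(4) by blast
      moreover have "(i, j) \<in> (\<Union>p\<in>P. p \<times> p)" using A by blast
      moreover have "(\<Union>p\<in>f P. p \<times> p) \<subseteq> (\<Union>p\<in>P. p \<times> p)" unfolding A(4) using A(1,2) by blast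
      ultimately show "(\<Union>p\<in>f P. p \<times> p) \<subset> (\<Union>p\<in>P. p \<times> p)" by blast
    qed
    show "I (compress f H)" if H: "H \<subseteq> set_partitions n" "I H" for H
    proof -
      have part: "partition_on {1..n} P" if "P \<in> H" for P using that H by (auto simp: set_partitions_def)
      have relH: "P = Q \<or> t_intersecting t P Q" if "P \<in> H" "Q \<in> H" for P Q
        using that H(2) by (auto simp: I_def rel_def)
      have "rel (compress f H)"
        unfolding rel_def
      proof (intro ballI)
        fix P Q assume PQ: "P \<in> compress f H" "Q \<in> compress f H"
        show "P = Q \<or> t_intersecting t P Q"
        proof (rule compress_rel[where R = "\<lambda>P Q. P = Q \<or> t_intersecting t P Q", OF _ _ _ _ PQ])
          show "P = Q \<or> t_intersecting t P Q" if "P \<in> H" "Q \<in> H" for P Q using relH that .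
          show "Q = P \<or> t_intersecting t Q P" if "P = Q \<or> t_intersecting t P Q" for P Q :: "nat set set"
            using that t_intersecting_sym by blast
          show "f P = Q \<or> t_intersecting t (f P) Q"
            if "P \<in> H" "Q \<in> H" "f P \<noteq> P" "P = Q \<or> t_intersecting t P Q" "P = f Q \<or> t_intersecting t P (f Q)" for P Q
            using t_intersecting_split_off_one[OF part[OF that(1)] part[OF that(2)] f(4)] that(3-5) f(1) by blast
          show "f P = f Q \<or> t_intersecting t (f P) (f Q)"
            if "P \<in> H" "Q \<in> H" "f P \<noteq> P" "f Q \<noteq> Q" "P = Q \<or> t_intersecting t P Q" for P Q
            using t_intersecting_split_off_both[OF part[OF that(1)] part[OF that(2)] f(4)] that(3-5) f(1) by blast
        qed
      qed
      moreover have "card (compress f H) = card H"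
        by (rule card_compress) (rule inj_on_subset[OF inj], use H in auto)
      moreover have "H = star n X" if "X \<subseteq> {1..n}" "card X = t" "t + 2 \<le> n" "compress f H = star n X" for X
        using compress_split_off_star[OF H(1) relH that(1-3) f(4,2,3)] that(4) f(1) by blast
      ultimately show ?thesis using H(2) unfolding I_def by metis
    qed
  qed (use F in auto)
  then obtain F' where F': "F' \<subseteq> set_partitions n" "I F'" "\<forall>f\<in>Fs. f ` F' \<subseteq> F'" by blast
  have "intersecting t (sing ` F')"
  proof (rule stable_sing_intersecting[OF F'(1)])
    show "split_off i j ` F' \<subseteq> F'" if "i \<in> {1..n}" "j \<in> {1..n}" "i \<noteq> j" for i j
      using bspec[OF F'(3), of "split_off i j"] that unfolding Fs_def by blast
  qed (use F'(2) two in \<open>auto simp: I_def rel_def\<close>)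
  then show thesis using that[of F'] F'(1,2) by (simp add: I_def)
qed

section \<open>Growth of the Bell numbers\<close>

text \<open>The recurrence \<open>Bell_Suc\<close> turns a combination of the series for smaller
  exponents into one with \<open>(k + 1) ^ j / fact k\<close> by the binomial theorem; this is the
  series for \<open>m = Suc j\<close> with its index moved by one.\<close>

lemma Bell_Dobinski: "(\<lambda>k. real k ^ m / fact k) sums (real (Bell m) * exp 1)"
proof (induction m rule: less_induct)
  case (less m)
  show ?case
  proof (cases m)
    case 0
    have "(\<lambda>k. (1::real) ^ k /\<^sub>R fact k) sums exp 1" by (rule exp_converges)
    then show ?thesis using 0 by (simp add: divide_inverse)
  next
    case (Suc j)
    have "(\<lambda>k. \<Sum>i\<le>j. real (j choose i) * (real k ^ i / fact k)) sums
        (\<Sum>i\<le>j. real (j choose i) * (real (Bell i) * exp 1))"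
      by (intro sums_sum sums_mult less.IH) (use Suc in auto)
    moreover have "(\<Sum>i\<le>j. real (j choose i) * (real (Bell i) * exp 1)) = real (Bell m) * exp 1"
      unfolding Suc Bell_Suc by (simp add: sum_distrib_right mult.assoc)
    moreover have "(\<Sum>i\<le>j. real (j choose i) * (real k ^ i / fact k)) = real (Suc k) ^ m / fact (Suc k)" for k
    proof -
      have "(\<Sum>i\<le>j. real (j choose i) * (real k ^ i / fact k)) = (real k + 1) ^ j / fact k"
        by (simp add: binomial_ring sum_divide_distrib)
      also have "\<dots> = (real (Suc k) * real (Suc k) ^ j) / (real (Suc k) * fact k)"
        by (simp add: add.commute)
      also have "\<dots> = real (Suc k) ^ m / fact (Suc k)" by (simp add: Suc)
      finally show ?thesis .
    qed
    ultimately have "(\<lambda>k. real (Suc k) ^ m / fact (Suc k)) sums (real (Bell m) * exp 1)" by simp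
    \<comment> \<open>The missing term at index 0 vanishes because \<open>m > 0\<close>.\<close>
    then show ?thesis using Suc by (subst (asm) sums_Suc_iff) simp
  qed
qed

text \<open>By Dobinski, \<open>Bell m\<close> is the \<open>m\<close>-th moment of the Poisson
  distribution with mean 1, and this is Cauchy-Schwarz for its moments. \<open>x\<close> minimizes
  the nonnegative quadratic given by the sum of \<open>(k - x) ^ 2 * k ^ m / fact k\<close>.\<close>

lemma Bell_log_convex: "(real (Bell (Suc m)))\<^sup>2 \<le> real (Bell m) * real (Bell (Suc (Suc m)))"
proof -
  define x where "x = real (Bell (Suc m)) / real (Bell m)"
  have pos: "real (Bell m) > 0" using Bell_pos by simp
  have "(\<lambda>k. real k ^ Suc (Suc m) / fact k - 2 * x * (real k ^ Suc m / fact k) + x\<^sup>2 * (real k ^ m / fact k)) sums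
      (real (Bell (Suc (Suc m))) * exp 1 - 2 * x * (real (Bell (Suc m)) * exp 1) + x\<^sup>2 * (real (Bell m) * exp 1))"
    by (intro sums_add sums_diff sums_mult Bell_Dobinski)
  moreover have "real k ^ Suc (Suc m) / fact k - 2 * x * (real k ^ Suc m / fact k) + x\<^sup>2 * (real k ^ m / fact k)
      = (real k - x)\<^sup>2 * (real k ^ m / fact k)" for k
    by (simp add: power2_eq_square algebra_simps add_divide_distrib diff_divide_distrib)
  ultimately have "(\<lambda>k. (real k - x)\<^sup>2 * (real k ^ m / fact k)) sums
      (real (Bell (Suc (Suc m))) * exp 1 - 2 * x * (real (Bell (Suc m)) * exp 1) + x\<^sup>2 * (real (Bell m) * exp 1))"
    by simp
  then have "0 \<le> real (Bell (Suc (Suc m))) * exp 1 - 2 * x * (real (Bell (Suc m)) * exp 1) + x\<^sup>2 * (real (Bell m) * exp 1)"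
    by (rule sums_le[OF _ sums_zero, rotated]) simp
  also have "\<dots> = (real (Bell (Suc (Suc m))) - 2 * x * real (Bell (Suc m)) + x\<^sup>2 * real (Bell m)) * exp 1"
    by (simp add: algebra_simps)
  finally have "0 \<le> real (Bell (Suc (Suc m))) - 2 * x * real (Bell (Suc m)) + x\<^sup>2 * real (Bell m)"
    by (simp add: zero_le_mult_iff)
  also have "\<dots> = real (Bell (Suc (Suc m))) - (real (Bell (Suc m)))\<^sup>2 / real (Bell m)"
    unfolding x_def using pos by (simp add: power2_eq_square field_simps)
  finally show ?thesis using pos by (simp add: field_simps)
qed

definition Bell_ratio :: "nat \<Rightarrow> real" where
  "Bell_ratio m = real (Bell (Suc m)) / real (Bell m)"

lemma Bell_ratio_pos: "Bell_ratio m > 0"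
  using Bell_pos by (simp add: Bell_ratio_def)

lemma Bell_ratio_mono: "i \<le> j \<Longrightarrow> Bell_ratio i \<le> Bell_ratio j"
proof (induction rule: dec_induct)
  case (step m)
  have "real (Bell m) > 0" "real (Bell (Suc m)) > 0" using Bell_pos by simp_all
  then have "Bell_ratio m \<le> Bell_ratio (Suc m)"
    using Bell_log_convex[of m] by (simp add: Bell_ratio_def divide_simps power2_eq_square mult.commute)
  then show ?case using step.IH by simp
qed simp

text \<open>\<open>Bell m\<close> is a product of \<open>m\<close> earlier ratios, none larger than
  \<open>Bell_ratio m\<close>.\<close>

lemma Bell_le_ratio_power: "real (Bell m) \<le> Bell_ratio m ^ m"
proof (induction m)
  case (Suc m)
  have "real (Bell (Suc m)) = Bell_ratio m * real (Bell m)"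
    using Bell_pos[of m] by (simp add: Bell_ratio_def)
  also have "\<dots> \<le> Bell_ratio m * Bell_ratio m ^ m"
    using Suc Bell_ratio_pos[of m] by simp
  also have "\<dots> \<le> Bell_ratio (Suc m) ^ Suc m"
    using power_mono[OF Bell_ratio_mono[of m "Suc m"], of "Suc m"] Bell_ratio_pos[of m] by simp
  finally show ?case .
qed simp

lemma Bell_ge_Dobinski_term: "real k ^ m / fact k \<le> real (Bell m) * exp 1"
proof -
  have "(\<Sum>i\<in>{k}. real i ^ m / fact i) \<le> (\<Sum>i. real i ^ m / fact i)"
    by (rule sum_le_suminf) (use Bell_Dobinski sums_summable in auto)
  then show ?thesis using sums_unique[OF Bell_Dobinski[of m]] by simp
qed

text \<open>Keep one Dobinski term: \<open>Bell j\<close> is at least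
  \<open>k ^ j / (fact k * exp 1)\<close>. Both \<open>fact k \<le> k ^ k\<close> and
  \<open>exp 1\<close> are at most \<open>exp j\<close>, so
  \<open>Bell j \<ge> (k / exp 2) ^ j\<close>; the \<open>j\<close>-th root passes to the ratio, and
  \<open>exp 2 \<le> 9\<close>.\<close>

lemma Bell_ratio_ge:
  assumes "k \<ge> 1" "j \<ge> 1" "real k * ln (real k) \<le> real j"
  shows "real k / 9 \<le> Bell_ratio j"
proof -
  have k: "real k > 0" using assms by simp
  have "fact k \<le> real k ^ k" using fact_le_power[of k] by simp
  also have "\<dots> = exp (real k * ln (real k))" using k by (simp add: exp_of_nat_mult)
  also have "\<dots> \<le> exp (real j)" using assms(3) by simp
  finally have f: "fact k \<le> exp (real j)" .
  have "(real k / exp 2) ^ j = real k ^ j / exp (2 * real j)"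
    by (simp add: power_divide exp_of_nat_mult[symmetric] mult.commute)
  also have "\<dots> \<le> real k ^ j / (exp (real j) * exp 1)"
  proof (rule divide_left_mono)
    show "exp (real j) * exp 1 \<le> exp (2 * real j)" using assms(2) by (simp flip: exp_add)
  qed auto
  also have "\<dots> = real k ^ j / exp (real j) / exp 1" by simp
  also have "\<dots> \<le> real k ^ j / fact k / exp 1"
    using f by (intro divide_right_mono divide_left_mono) auto
  also have "\<dots> \<le> real (Bell j)" using Bell_ge_Dobinski_term[of k j] by (simp add: field_simps)
  also have "\<dots> \<le> Bell_ratio j ^ j" by (rule Bell_le_ratio_power)
  finally have "real k / exp 2 \<le> Bell_ratio j"
    using assms(2) Bell_ratio_pos[of j] power_mono_iff[of "real k / exp 2" "Bell_ratio j" j] by simp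
  moreover have "exp 2 \<le> (9::real)"
  proof -
    have "exp 2 = exp 1 * (exp 1 :: real)" by (simp flip: exp_add)
    also have "\<dots> \<le> 3 * 3" by (intro mult_mono exp_le) auto
    finally show ?thesis by simp
  qed
  then have "real k / 9 \<le> real k / exp 2" by (intro divide_left_mono) auto
  ultimately show ?thesis by (rule order_trans[rotated])
qed

lemma Bell_diff_le:
  assumes "k \<ge> 1" "j \<ge> 1" "real k * ln (real k) \<le> real j" "j + l \<le> m"
  shows "real (Bell (m - l)) \<le> (9 / real k) ^ l * real (Bell m)"
  using assms(4)
proof (induction l)
  case (Suc l)
  have m: "m - l = Suc (m - Suc l)" using Suc.prems assms(2) by simp
  have "real k / 9 \<le> Bell_ratio (m - Suc l)"
  proof -
    have "j \<le> m - Suc l" using Suc.prems by simp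
    then show ?thesis using Bell_ratio_ge[OF assms(1-3)] Bell_ratio_mono by (meson order_trans)
  qed
  then have "real (Bell (m - Suc l)) \<le> 9 / real k * real (Bell (m - l))"
    using Bell_pos[of "m - Suc l"] assms(1) unfolding m Bell_ratio_def by (simp add: field_simps)
  also have "\<dots> \<le> 9 / real k * ((9 / real k) ^ l * real (Bell m))"
    using Suc by (intro mult_left_mono) auto
  finally show ?case by simp
qed simp

section \<open>Intersecting families of sets of singletons\<close>

lemma card_sing_union_bound:
  assumes "\<E> \<subseteq> Pow {1..n}" "\<And>E. E \<in> \<E> \<Longrightarrow> card E = c"
  shows "card {P \<in> set_partitions n. \<exists>E\<in>\<E>. E \<subseteq> sing P} \<le> card \<E> * Bell (n - c)"
proof -
  have fin: "finite \<E>" using assms(1) by (rule finite_subset) simp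
  have "{P \<in> set_partitions n. \<exists>E\<in>\<E>. E \<subseteq> sing P} = (\<Union>E\<in>\<E>. {P \<in> set_partitions n. E \<subseteq> sing P})" by auto
  then have "card {P \<in> set_partitions n. \<exists>E\<in>\<E>. E \<subseteq> sing P} \<le> (\<Sum>E\<in>\<E>. card {P \<in> set_partitions n. E \<subseteq> sing P})"
    using card_UN_le[OF fin, of "\<lambda>E. {P \<in> set_partitions n. E \<subseteq> sing P}"] by simp
  also have "\<dots> = (\<Sum>E\<in>\<E>. Bell (n - c))"
    by (rule sum.cong) (use assms card_sing_superset in auto)
  finally show ?thesis by simp
qed

lemma card_sing_family_cong:
  assumes "G \<subseteq> Pow {1..n}" "H \<subseteq> Pow {1..n}"
    and "\<And>k. card {S \<in> G. card S = k} = card {S \<in> H. card S = k}"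
  shows "card {P \<in> set_partitions n. sing P \<in> G} = card {P \<in> set_partitions n. sing P \<in> H}"
  using sum_by_card[OF assms(1), of "\<lambda>k. bell0 (n - k)"] sum_by_card[OF assms(2), of "\<lambda>k. bell0 (n - k)"]
    assms(3) by (simp add: card_sing_family[OF assms(1)] card_sing_family[OF assms(2)])

section \<open>Numerical estimates for the union bound\<close>

lemma geometric_sum_le:
  "(\<Sum>l\<in>{a..<b}. (1/8) ^ l) \<le> (8/7 :: real) * (1/8) ^ a"
proof (cases "a \<le> b")
  case True
  then have "(\<Sum>l\<in>{a..<b}. (1/8) ^ l) + (8/7) * (1/8) ^ b = (8/7 :: real) * (1/8) ^ a"
    by (induction rule: dec_induct) auto
  moreover have "(0::real) \<le> (8/7) * (1/8) ^ b" by simp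
  ultimately show ?thesis by linarith
qed simp

text \<open>With \<open>N = t + 2 * l\<close>, one step of \<open>l\<close> costs at most
  \<open>2 * (3 * t)\<close>: a factor 2 from \<open>N choose l\<close> to
  \<open>Suc N choose l\<close>, then \<open>(N + 2) / (l + 1)\<close>, at most
  \<open>3 * t\<close>, to the next binomial.\<close>

lemma binomial_walk_le:
  assumes "t \<ge> 1"
  shows "(t + 2 * l) choose (t + l) \<le> (6 * t) ^ l"
proof (induction l)
  case (Suc l)
  let ?N = "t + 2 * l"
  have e1: "Suc l * (Suc (Suc ?N) choose (Suc l)) = Suc (Suc ?N) * (Suc ?N choose l)"
    using Suc_times_binomial_eq[of "Suc ?N" l] by (simp only: mult.commute)
  have e2: "(Suc ?N choose l) * (Suc ?N - l) = Suc ?N * (?N choose l)"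
    using binomial_absorb_comp[of "Suc ?N" l] by (simp only: diff_Suc_1 mult.commute)
  have d: "Suc ?N - l = t + l + 1" by simp
  have a1: "Suc ?N choose l \<le> 2 * (?N choose l)"
  proof -
    have "(Suc ?N choose l) * (t + l + 1) \<le> (2 * (?N choose l)) * (t + l + 1)"
      using e2 unfolding d by (simp add: algebra_simps)
    then show ?thesis using mult_le_cancel2[of _ "t + l + 1"] by simp
  qed
  have a2: "Suc (Suc ?N) choose Suc l \<le> 3 * t * (Suc ?N choose l)"
  proof -
    have "Suc (Suc ?N) \<le> 3 * t * Suc l" using assms
    proof (induction l)
      case (Suc l)
      then show ?case by simp
    qed simp
    then have "Suc l * (Suc (Suc ?N) choose (Suc l)) \<le> 3 * t * Suc l * (Suc ?N choose l)"
      unfolding e1 by (rule mult_le_mono1)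
    then have "Suc l * (Suc (Suc ?N) choose (Suc l)) \<le> Suc l * (3 * t * (Suc ?N choose l))"
      by (simp only: mult_ac)
    then show ?thesis by (simp only: Suc_mult_le_cancel1)
  qed
  have sym: "?N choose l = ?N choose (t + l)"
    using binomial_symmetric[of l ?N] by (simp add: add.commute)
  have sym': "Suc (Suc ?N) choose (Suc l) = Suc (Suc ?N) choose (t + Suc l)"
    using binomial_symmetric[of "Suc l" "Suc (Suc ?N)"] by (simp add: add.commute del: binomial_Suc_Suc)
  have "Suc (Suc ?N) choose Suc l \<le> 3 * t * (2 * (?N choose l))"
    using a2 mult_le_mono2[OF a1, of "3 * t"] by linarith
  also have "\<dots> = 6 * t * (?N choose (t + l))" using sym by simp
  also have "\<dots> \<le> 6 * t * (6 * t) ^ l" using Suc.IH by (rule mult_le_mono2)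
  finally show ?case unfolding sym' by simp
qed simp

lemma fact_ge_power: "(real v / 3) ^ v \<le> fact v"
proof -
  have "(\<Sum>i\<in>{v}. real v ^ i /\<^sub>R fact i) \<le> (\<Sum>i. real v ^ i /\<^sub>R fact i)"
    by (rule sum_le_suminf) (use summable_exp_generic[of "real v"] in auto)
  then have "real v ^ v / fact v \<le> exp (real v)" by (simp add: exp_def divide_inverse mult.commute)
  also have "exp (real v) = exp 1 ^ v" by (simp flip: exp_of_nat_mult)
  also have "\<dots> \<le> 3 ^ v" by (intro power_mono exp_le) simp
  finally show ?thesis by (simp add: power_divide field_simps)
qed

text \<open>\<open>(n choose v) * fact v \<le> n ^ v\<close> and
  \<open>fact v \<ge> (v / 3) ^ v\<close> leave \<open>(3 * n * \<rho> / v) ^ v\<close>, whose base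
  is at most \<open>1/2\<close>.\<close>

lemma binomial_power_le:
  assumes "v \<ge> 1" "\<rho> \<ge> 0" "6 * real n * \<rho> \<le> real v"
  shows "real (n choose v) * \<rho> ^ v \<le> (1/2) ^ v"
proof -
  have f: "fact v > (0::real)" by simp
  have "(n choose v) * fact v \<le> n ^ v" by (rule binomial_fact_pow)
  then have "real (n choose v) * fact v \<le> real n ^ v"
    by (metis of_nat_fact of_nat_le_iff of_nat_mult of_nat_power)
  then have "real (n choose v) * fact v * \<rho> ^ v \<le> real n ^ v * \<rho> ^ v"
    using assms(2) by (intro mult_right_mono) auto
  also have "\<dots> = (real n * \<rho>) ^ v" by (simp add: power_mult_distrib)
  also have "\<dots> \<le> (1/2 * (real v / 3)) ^ v" using assms by (intro power_mono) auto
  also have "\<dots> \<le> (1/2) ^ v * fact v"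
    unfolding power_mult_distrib using fact_ge_power by (intro mult_left_mono) auto
  finally have "(real (n choose v) * \<rho> ^ v) * fact v \<le> (1/2) ^ v * fact v" by (simp add: mult_ac)
  then show ?thesis using f by (simp only: mult_le_cancel_right_pos)
qed

text \<open>
  \<open>k\<close> and \<open>v\<close> are of order \<open>m / ln m\<close> and \<open>ln m\<close>; passing from \<open>Bell i\<close> to \<open>Bell (i - 1)\<close> with
  \<open>i\<close> close to \<open>m\<close> costs a factor \<open>9 / k\<close>. If some \<open>T\<close> in the shifted family misses a point of
  \<open>{1..t}\<close> and has at most \<open>t + 2 * v\<close> elements, then only a small part of the star of \<open>{1..t}\<close> meets
  \<open>T\<close> in \<open>t\<close> points. Otherwise the sets not containing \<open>{1..t}\<close> are so large that they contribute
  less than the missing set \<open>{1..t}\<close> itself.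
\<close>

lemma intersecting_family_bound:
  assumes G: "G \<subseteq> Pow {1..n}" "intersecting t G" and noX: "\<And>S. S \<in> G \<Longrightarrow> card S \<noteq> t"
    and t: "t \<ge> 1" "n = t + m" and m2: "m \<ge> 2"
    and k: "k \<ge> 1" "real k * ln (real k) \<le> real (m div 2)" "432 * t \<le> k" "72 * v \<le> k"
    and v: "v \<ge> 1" "m\<^sup>2 \<le> 2 ^ v" "54 * n \<le> k * v" "4 * v \<le> m"
  shows "card {P \<in> set_partitions n. sing P \<in> G} < Bell m"
proof -
  obtain H where H: "H \<subseteq> Pow {1..n}" "intersecting t H" "shifted H"
    and lev: "\<And>j. card {S \<in> H. card S = j} = card {S \<in> G. card S = j}"
    using shifted_family_exists[OF G] by blast
  have finH: "finite H" using H(1) by (rule finite_subset) simp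
  have "{S \<in> G. card S = t} = {}" using noX by blast
  then have "card {S \<in> H. card S = t} = 0" using lev[of t] by (metis card.empty)
  then have noXH: "card S \<noteq> t" if "S \<in> H" for S using that finH by auto
  define N where "N K = card {P \<in> set_partitions n. sing P \<in> K}" for K :: "nat set set"
  define H0 where "H0 = {S \<in> H. {1..t} \<subseteq> S}"
  define H1 where "H1 = {S \<in> H. \<not> {1..t} \<subseteq> S}"
  \<comment> \<open>\<open>\<rho>\<close> is the price of one more singleton. In these terms
    \<open>432 * t \<le> k\<close> says \<open>6 * t * \<rho> \<le> 1/8\<close>, and
    \<open>54 * n \<le> k * v\<close> says \<open>6 * n * \<rho> \<le> v\<close>; the bounds on
    \<open>t\<close> and \<open>v\<close> by \<open>k\<close> give
    \<open>(t + 2 * v) * \<rho> \<le> 1/2\<close>. \<open>4 * v \<le> m\<close> keeps all indices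
    above \<open>m div 2\<close>, where the price is valid.\<close>
  define \<rho> where "\<rho> = 9 / real k"
  define B where "B = real (Bell m)"
  \<comment> \<open>\<open>W l\<close> contains the possible prefixes of a member whose walk has
    height \<open>t\<close> after \<open>t + 2 * l\<close> steps.\<close>
  define W where "W l = {E. E \<subseteq> {1..t + 2 * l} \<and> card E = t + l}" for l
  have B: "B > 0" using Bell_pos by (simp add: B_def)
  have \<rho>: "\<rho> \<ge> 0" by (simp add: \<rho>_def)
  have "N G = N H" unfolding N_def by (rule card_sing_family_cong) (use G H lev in auto)
  also have "\<dots> \<le> N H0 + N H1"
  proof -
    have "{P \<in> set_partitions n. sing P \<in> H} =
        {P \<in> set_partitions n. sing P \<in> H0} \<union> {P \<in> set_partitions n. sing P \<in> H1}"
      by (auto simp: H0_def H1_def)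
    then show ?thesis unfolding N_def by (simp only: card_Un_le)
  qed
  finally have N: "real (N G) \<le> real (N H0) + real (N H1)" by simp
  have Bdiff: "real (Bell (m - l)) \<le> \<rho> ^ l * B" if "2 * l \<le> m" for l
    unfolding \<rho>_def B_def by (rule Bell_diff_le[OF k(1) _ k(2)]) (use that m2 in auto)
  have cW: "card (W l) = (t + 2 * l) choose (t + l)" for l
    using n_subsets[of "{1..t + 2 * l}" "t + l"] by (simp add: W_def)
  have Wsub: "W l \<subseteq> Pow {1..n}" if "2 * l \<le> m" for l using that t(2) by (auto simp: W_def subset_iff)
  have Weps: "real (card (W l)) * \<rho> ^ l \<le> (1/8) ^ l" for l
  proof -
    have "real (card (W l)) \<le> (6 * real t) ^ l"
      unfolding cW using binomial_walk_le[OF t(1), of l]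
      by (metis of_nat_le_iff of_nat_mult of_nat_numeral of_nat_power)
    then have "real (card (W l)) * \<rho> ^ l \<le> (6 * real t) ^ l * \<rho> ^ l" using \<rho> by (intro mult_right_mono) auto
    also have "\<dots> = (6 * real t * \<rho>) ^ l" by (simp add: power_mult_distrib)
    also have "\<dots> \<le> (1/8) ^ l"
    proof (rule power_mono)
      have "432 * real t \<le> real k" using k(3) by (metis of_nat_le_iff of_nat_mult of_nat_numeral)
      then show "6 * real t * \<rho> \<le> 1/8" using k(1) by (simp add: \<rho>_def field_simps)
    qed (use \<rho> in simp)
    finally show ?thesis .
  qed
  have walk: "\<exists>l. 1 \<le> l \<and> 2 * l \<le> m \<and> (\<exists>E\<in>W l. E \<subseteq> S)" if "S \<in> H1" for S
  proof -
    have S: "S \<in> H" "\<not> {1..t} \<subseteq> S" using that by (auto simp: H1_def)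
    obtain l where l: "t + 2 * l \<le> n" "card (S \<inter> {1..t + 2 * l}) = t + l"
      using shifted_walk[OF H(3,2,1) t(1) S(1)] .
    have "l \<noteq> 0"
    proof
      assume "l = 0"
      then have "S \<inter> {1..t} = {1..t}" using l(2) by (intro card_subset_eq) auto
      then show False using S(2) by blast
    qed
    moreover have "S \<inter> {1..t + 2 * l} \<in> W l" using l(2) by (simp add: W_def)
    ultimately show ?thesis using l(1) t(2) by (intro exI[of _ l]) auto
  qed
  have base: "real (card (W l)) * real (Bell (m - l)) \<le> (1/8) ^ l * B" if "2 * l \<le> m" for l
  proof -
    have "real (card (W l)) * real (Bell (m - l)) \<le> real (card (W l)) * (\<rho> ^ l * B)"
      using Bdiff[OF that] by (intro mult_left_mono) auto
    also have "\<dots> \<le> (1/8) ^ l * B" using Weps[of l] B by (simp add: mult.assoc[symmetric])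
    finally show ?thesis .
  qed
  have levels: "real (N H1) \<le> (\<Sum>l\<in>{1..<Suc (m div 2)}. real (card {P \<in> set_partitions n. sing P \<in> H1 \<and> (\<exists>E\<in>W l. E \<subseteq> sing P)}))"
  proof -
    have "{P \<in> set_partitions n. sing P \<in> H1} \<subseteq>
        (\<Union>l\<in>{1..<Suc (m div 2)}. {P \<in> set_partitions n. sing P \<in> H1 \<and> (\<exists>E\<in>W l. E \<subseteq> sing P)})"
    proof
      fix P assume "P \<in> {P \<in> set_partitions n. sing P \<in> H1}"
      then have P: "P \<in> set_partitions n" "sing P \<in> H1" by auto
      obtain l where l: "1 \<le> l" "2 * l \<le> m" "\<exists>E\<in>W l. E \<subseteq> sing P" using walk[OF P(2)] by blast
      then have "l \<in> {1..<Suc (m div 2)}" by auto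
      then show "P \<in> (\<Union>l\<in>{1..<Suc (m div 2)}. {P \<in> set_partitions n. sing P \<in> H1 \<and> (\<exists>E\<in>W l. E \<subseteq> sing P)})"
        using P l(3) by blast
    qed
    then have "N H1 \<le> card (\<Union>l\<in>{1..<Suc (m div 2)}. {P \<in> set_partitions n. sing P \<in> H1 \<and> (\<exists>E\<in>W l. E \<subseteq> sing P)})"
      unfolding N_def by (intro card_mono) auto
    also have "\<dots> \<le> (\<Sum>l\<in>{1..<Suc (m div 2)}. card {P \<in> set_partitions n. sing P \<in> H1 \<and> (\<exists>E\<in>W l. E \<subseteq> sing P)})"
      by (rule card_UN_le) simp
    finally have "real (N H1) \<le> real (\<Sum>l\<in>{1..<Suc (m div 2)}. card {P \<in> set_partitions n. sing P \<in> H1 \<and> (\<exists>E\<in>W l. E \<subseteq> sing P)})"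
      by (simp only: of_nat_le_iff)
    then show ?thesis by (simp only: of_nat_sum)
  qed
  have level_base: "real (card {P \<in> set_partitions n. sing P \<in> H1 \<and> (\<exists>E\<in>W l. E \<subseteq> sing P)}) \<le> (1/8) ^ l * B"
    if l: "2 * l \<le> m" for l
  proof -
    have "card {P \<in> set_partitions n. sing P \<in> H1 \<and> (\<exists>E\<in>W l. E \<subseteq> sing P)}
        \<le> card {P \<in> set_partitions n. \<exists>E\<in>W l. E \<subseteq> sing P}" by (rule card_mono) auto
    also have "\<dots> \<le> card (W l) * Bell (n - (t + l))"
      by (rule card_sing_union_bound[OF Wsub[OF l]]) (simp add: W_def)
    also have "n - (t + l) = m - l" using t(2) by simp
    finally have "real (card {P \<in> set_partitions n. sing P \<in> H1 \<and> (\<exists>E\<in>W l. E \<subseteq> sing P)})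
        \<le> real (card (W l)) * real (Bell (m - l))"
      by (simp only: of_nat_le_iff flip: of_nat_mult)
    then show ?thesis using base[OF l] by linarith
  qed
  show ?thesis
  proof (cases "\<exists>T\<in>H1. card T \<le> t + 2 * v")
    case True
    then obtain T where T: "T \<in> H" "\<not> {1..t} \<subseteq> T" "card T \<le> t + 2 * v" by (auto simp: H1_def)
    have fT: "finite T" and Tn: "T \<subseteq> {1..n}" using T(1) H(1) finite_subset by blast+
    let ?E = "(\<lambda>x. insert x {1..t}) ` (T - {1..t})"
    \<comment> \<open>\<open>T\<close> has fewer than \<open>t\<close> points in
      \<open>{1..t}\<close>, so each member of \<open>H0\<close> shares a further point
      \<open>x\<close> with \<open>T\<close>. The at most \<open>t + 2 * v\<close> choices of
      \<open>x\<close> leave half of \<open>B\<close> for \<open>H0\<close>, and \<open>H1\<close>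
      takes at most \<open>1/7\<close> of it.\<close>
    have "{P \<in> set_partitions n. sing P \<in> H0} \<subseteq> {P \<in> set_partitions n. \<exists>E\<in>?E. E \<subseteq> sing P}"
    proof
      fix P assume "P \<in> {P \<in> set_partitions n. sing P \<in> H0}"
      then have P: "P \<in> set_partitions n" "sing P \<in> H0" by auto
      have sP: "sing P \<in> H" "{1..t} \<subseteq> sing P" using P(2) by (auto simp: H0_def)
      have "t \<le> card (T \<inter> sing P)" using intersectingD[OF H(2) T(1) sP(1)] .
      moreover have "card (T \<inter> {1..t}) < card {1..t}" using T(2) by (intro psubset_card_mono) auto
      ultimately have "\<not> T \<inter> sing P \<subseteq> T \<inter> {1..t}"
        using card_mono[of "T \<inter> {1..t}" "T \<inter> sing P"] fT by auto
      then obtain x where "x \<in> T - {1..t}" "x \<in> sing P" by blast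
      then have "insert x {1..t} \<in> ?E" "insert x {1..t} \<subseteq> sing P" using sP(2) by blast+
      then show "P \<in> {P \<in> set_partitions n. \<exists>E\<in>?E. E \<subseteq> sing P}" using P(1) by blast
    qed
    then have "N H0 \<le> card {P \<in> set_partitions n. \<exists>E\<in>?E. E \<subseteq> sing P}"
      unfolding N_def by (intro card_mono) auto
    also have "\<dots> \<le> card ?E * Bell (n - Suc t)"
      by (rule card_sing_union_bound) (use Tn t(2) in auto)
    also have "\<dots> \<le> (t + 2 * v) * Bell (n - Suc t)"
    proof (rule mult_le_mono1)
      have "card ?E \<le> card (T - {1..t})" by (rule card_image_le) (use fT in simp)
      also have "\<dots> \<le> card T" by (rule card_mono) (use fT in auto)
      finally show "card ?E \<le> t + 2 * v" using T(3) by simp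
    qed
    also have "n - Suc t = m - 1" using t(2) by simp
    finally have "real (N H0) \<le> real (t + 2 * v) * real (Bell (m - 1))"
      by (simp only: of_nat_le_iff flip: of_nat_mult)
    also have "\<dots> \<le> real (t + 2 * v) * (\<rho> * B)"
      using Bdiff[of 1] m2 by (intro mult_left_mono) auto
    also have "\<dots> = (real (t + 2 * v) * \<rho>) * B" by simp
    also have "\<dots> \<le> 1/2 * B"
    proof (rule mult_right_mono)
      have "36 * t \<le> 432 * t" by simp
      then have "36 * t \<le> k" using k(3) by (rule order_trans)
      then have "18 * t + 36 * v \<le> k" using k(4) by linarith
      then have "18 * (t + 2 * v) \<le> k" by simp
      then have "18 * real (t + 2 * v) \<le> real k" by (metis of_nat_le_iff of_nat_mult of_nat_numeral)
      then show "real (t + 2 * v) * \<rho> \<le> 1/2" using k(1) by (simp add: \<rho>_def field_simps)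
    qed (use B in simp)
    finally have 1: "real (N H0) \<le> 1/2 * B" .
    have "real (N H1) \<le> (\<Sum>l\<in>{1..<Suc (m div 2)}. (1/8) ^ l * B)"
      using levels by (rule order_trans) (intro sum_mono level_base, auto)
    also have "\<dots> = (\<Sum>l\<in>{1..<Suc (m div 2)}. (1/8) ^ l) * B" by (simp only: sum_distrib_right)
    also have "\<dots> \<le> (8/7 * (1/8) ^ 1) * B" by (rule mult_right_mono[OF geometric_sum_le]) (use B in simp)
    finally have "real (N H1) \<le> 1/7 * B" by simp
    then have "real (N G) < B" using N 1 B by linarith
    then show ?thesis by (simp add: N_def B_def)
  next
    case False
    then have big: "card T > t + 2 * v" if "T \<in> H1" for T using that by force
    have tn: "{1..t} \<subseteq> {1..n}" using t(2) by auto
    \<comment> \<open>The partitions with singletons exactly \<open>{1..t}\<close> lie in the star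
      but are not counted for \<open>H0\<close>. The count for \<open>H1\<close> has to stay below
      this reserve.\<close>
    have "N H0 + bell0 m \<le> Bell m"
    proof -
      have "bell0 m = card {P \<in> set_partitions n. sing P = {1..t}}"
        using card_sing_eq[OF tn] t(2) by simp
      moreover have "{1..t} \<notin> H" using noXH by force
      then have "{P \<in> set_partitions n. sing P \<in> H0} \<inter> {P \<in> set_partitions n. sing P = {1..t}} = {}"
        by (auto simp: H0_def)
      ultimately have "N H0 + bell0 m = card ({P \<in> set_partitions n. sing P \<in> H0} \<union> {P \<in> set_partitions n. sing P = {1..t}})"
        unfolding N_def by (subst card_Un_disjoint) auto
      also have "\<dots> \<le> card {P \<in> set_partitions n. {1..t} \<subseteq> sing P}"
        by (rule card_mono) (auto simp: H0_def)
      also have "\<dots> = Bell m" using card_sing_superset[OF tn] t(2) by simp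
      finally show ?thesis .
    qed
    then have 1: "real (N H0) + real (bell0 m) \<le> B" unfolding B_def by linarith
    \<comment> \<open>Members of \<open>H1\<close> now have more than \<open>t + 2 * v\<close>
      points, so beyond a prefix with \<open>t + l\<close> points they contain \<open>v\<close>
      more, which gains \<open>(1/2) ^ v\<close>. For \<open>l \<ge> v\<close> the factor
      \<open>(1/8) ^ l\<close> alone is small enough.\<close>
    have small: "real (card {P \<in> set_partitions n. sing P \<in> H1 \<and> (\<exists>E\<in>W l. E \<subseteq> sing P)}) \<le> (1/8) ^ l * ((1/2) ^ v * B)"
      if l: "l < v" for l
    proof -
      have l2: "2 * l \<le> m" using l v(4) by simp
      define V where "V = {D. D \<subseteq> {1..n} \<and> card D = v}"
      define \<E> where "\<E> = {E \<union> D | E D. E \<in> W l \<and> D \<in> V \<and> E \<inter> D = {}}"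
      have finW: "finite (W l)" using Wsub[OF l2] by (rule finite_subset) simp
      have finV: "finite V" by (rule finite_subset[of _ "Pow {1..n}"]) (auto simp: V_def)
      have fE: "finite E" if "E \<in> W l" for E using that finite_subset by (auto simp: W_def)
      have fD: "finite D" if "D \<in> V" for D using that finite_subset by (auto simp: V_def)
      have "\<E> \<subseteq> (\<lambda>(E, D). E \<union> D) ` (W l \<times> V)" by (auto simp: \<E>_def)
      then have "card \<E> \<le> card (W l \<times> V)"
        using finW finV by (meson card_image_le card_mono finite_SigmaI finite_imageI order_trans)
      then have c\<E>: "card \<E> \<le> card (W l) * (n choose v)"
        using n_subsets[of "{1..n}" v] by (simp add: card_cartesian_product V_def)
      have "{P \<in> set_partitions n. sing P \<in> H1 \<and> (\<exists>E\<in>W l. E \<subseteq> sing P)} \<subseteq> {P \<in> set_partitions n. \<exists>E\<in>\<E>. E \<subseteq> sing P}"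
      proof clarify
        fix P E assume P: "P \<in> set_partitions n" "sing P \<in> H1" and E: "E \<in> W l" "E \<subseteq> sing P"
        have sub: "sing P \<subseteq> {1..n}" using P(2) H(1) by (auto simp: H1_def)
        have "card (sing P - E) = card (sing P) - card E" using E(2) fE[OF E(1)] by (simp add: card_Diff_subset)
        also have "card E = t + l" using E(1) by (simp add: W_def)
        finally have "v \<le> card (sing P - E)" using big[OF P(2)] l by simp
        then obtain D where D: "D \<subseteq> sing P - E" "card D = v" using obtain_subset_with_card_n by metis
        then have "D \<in> V" using sub by (auto simp: V_def)
        then have "E \<union> D \<in> \<E>" using E(1) D(1) unfolding \<E>_def by blast
        moreover have "E \<union> D \<subseteq> sing P" using E(2) D(1) by blast
        ultimately show "\<exists>E\<in>\<E>. E \<subseteq> sing P" by blast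
      qed
      then have "card {P \<in> set_partitions n. sing P \<in> H1 \<and> (\<exists>E\<in>W l. E \<subseteq> sing P)}
          \<le> card {P \<in> set_partitions n. \<exists>E\<in>\<E>. E \<subseteq> sing P}" by (intro card_mono) auto
      also have "\<dots> \<le> card \<E> * Bell (n - (t + l + v))"
      proof (rule card_sing_union_bound)
        show "\<E> \<subseteq> Pow {1..n}" using Wsub[OF l2] by (auto simp: \<E>_def V_def)
        fix A assume "A \<in> \<E>"
        then obtain E D where ED: "A = E \<union> D" "E \<in> W l" "D \<in> V" "E \<inter> D = {}"
          unfolding \<E>_def by blast
        have "card A = card E + card D"
          unfolding ED(1) by (rule card_Un_disjoint[OF fE[OF ED(2)] fD[OF ED(3)] ED(4)])
        then show "card A = t + l + v" using ED(2,3) by (simp add: W_def V_def)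
      qed
      also have "\<dots> \<le> card (W l) * (n choose v) * Bell (n - (t + l + v))"
        using c\<E> by (rule mult_le_mono1)
      also have "n - (t + l + v) = m - (l + v)" using t(2) by simp
      finally have "real (card {P \<in> set_partitions n. sing P \<in> H1 \<and> (\<exists>E\<in>W l. E \<subseteq> sing P)})
          \<le> real (card (W l)) * real (n choose v) * real (Bell (m - (l + v)))"
        by (simp only: of_nat_le_iff flip: of_nat_mult)
      also have "\<dots> \<le> real (card (W l)) * real (n choose v) * (\<rho> ^ (l + v) * B)"
        using Bdiff[of "l + v"] l v(4) by (intro mult_left_mono) auto
      also have "\<dots> = (real (card (W l)) * \<rho> ^ l) * ((real (n choose v) * \<rho> ^ v) * B)"
        by (simp add: power_add)
      also have "\<dots> \<le> (1/8) ^ l * ((1/2) ^ v * B)"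
      proof (intro mult_mono Weps binomial_power_le[OF v(1) \<rho>])
        have "54 * real n \<le> real k * real v" using v(3) by (metis of_nat_le_iff of_nat_mult of_nat_numeral)
        then show "6 * real n * \<rho> \<le> real v" using k(1) by (simp add: \<rho>_def field_simps)
      qed (use B \<rho> in auto)
      finally show ?thesis .
    qed
    have vm: "v \<le> Suc (m div 2)" using v(4) by linarith
    have "real (N H1) \<le> (\<Sum>l\<in>{1..<Suc (m div 2)}. if l < v then (1/8) ^ l * ((1/2) ^ v * B) else (1/8) ^ l * B)"
      using levels
    proof (rule order_trans, intro sum_mono)
      fix l assume l: "l \<in> {1..<Suc (m div 2)}"
      then have "2 * l \<le> m" by auto
      then show "real (card {P \<in> set_partitions n. sing P \<in> H1 \<and> (\<exists>E\<in>W l. E \<subseteq> sing P)})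
          \<le> (if l < v then (1/8) ^ l * ((1/2) ^ v * B) else (1/8) ^ l * B)"
        using small[of l] level_base[of l] by auto
    qed
    also have "\<dots> = (\<Sum>l\<in>{1..<v}. (1/8) ^ l * ((1/2) ^ v * B)) + (\<Sum>l\<in>{v..<Suc (m div 2)}. (1/8) ^ l * B)"
      using sum.atLeastLessThan_concat[OF v(1) vm, of "\<lambda>l. if l < v then (1/8) ^ l * ((1/2) ^ v * B) else (1/8) ^ l * B"]
      by simp
    also have "\<dots> = (\<Sum>l\<in>{1..<v}. (1/8) ^ l) * ((1/2) ^ v * B) + (\<Sum>l\<in>{v..<Suc (m div 2)}. (1/8) ^ l) * B"
      by (simp only: sum_distrib_right)
    also have "\<dots> \<le> (8/7 * (1/8) ^ 1) * ((1/2) ^ v * B) + (8/7 * (1/8) ^ v) * B"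
      by (intro add_mono mult_right_mono geometric_sum_le) (use B in auto)
    \<comment> \<open>The left side is at most \<open>1/7 + 8/7 * 1/4 = 3/7\<close> of the right
      side.\<close>
    also have "\<dots> < (1/2) ^ v * B"
    proof -
      have "(1/4 :: real) ^ v \<le> (1/4) ^ 1" using v(1) by (intro power_decreasing) auto
      then have "(1/8 :: real) ^ v \<le> (1/4) * (1/2) ^ v"
        using mult_right_mono[of "(1/4 :: real) ^ v" "1/4" "(1/2) ^ v"] by (simp flip: power_mult_distrib)
      then have "(1/8) ^ v * B \<le> (1/4 * (1/2) ^ v) * B"
        using B by (intro mult_right_mono) auto
      then have "(1/8) ^ v * B \<le> 1/4 * ((1/2) ^ v * B)" by (simp only: mult.assoc)
      moreover have "(1/2) ^ v * B > 0" using B by simp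
      moreover have "(8/7 * (1/8) ^ 1) * ((1/2) ^ v * B) + (8/7 * (1/8) ^ v) * B
          = 1/7 * ((1/2) ^ v * B) + 8/7 * ((1/8) ^ v * B)" by simp
      ultimately show ?thesis by linarith
    qed
    \<comment> \<open>The chain is
      \<open>Bell m \<le> m^2 * Bell (m - 2) \<le> 2 ^ v * bell0 m\<close>; this is the purpose of
      the lower bound on \<open>v\<close>.\<close>
    also have "\<dots> \<le> real (bell0 m)"
    proof -
      obtain i where i: "m = Suc (Suc i)" using m2 by (metis add_2_eq_Suc le_Suc_ex)
      have "Bell m \<le> m * (Suc i * Bell i)"
        using Bell_Suc_le[of "Suc i"] mult_le_mono2[OF Bell_Suc_le[of i], of m] unfolding i by (meson order_trans)
      also have "\<dots> \<le> m * (m * Bell i)" unfolding i by (intro mult_le_mono) auto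
      also have "\<dots> \<le> 2 ^ v * Bell i" using mult_le_mono1[OF v(2), of "Bell i"] by (simp add: power2_eq_square)
      also have "\<dots> \<le> 2 ^ v * bell0 m" using Bell_le_bell0[of i] by (simp add: i)
      finally have "B \<le> 2 ^ v * real (bell0 m)"
        unfolding B_def by (metis of_nat_le_iff of_nat_mult of_nat_numeral of_nat_power)
      then show ?thesis by (simp add: power_divide field_simps)
    qed
    finally have "real (N G) < B" using N 1 by linarith
    then show ?thesis by (simp add: N_def B_def)
  qed
qed

lemma card_star_level:
  assumes "n \<ge> 1"
  shows "card {S \<in> {S \<in> Pow {1..n}. {1} \<subseteq> S}. card S = k} = (if k = 0 then 0 else (n - 1) choose (k - 1))"
proof (cases "k = 0")
  case True
  have "card S \<noteq> 0" if "S \<subseteq> {1..n}" "1 \<in> S" for S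
    using finite_subset[OF that(1)] that(2) by auto
  then have "{S \<in> {S \<in> Pow {1..n}. {1} \<subseteq> S}. card S = k} = {}" using True by auto
  then show ?thesis using True by simp
next
  case False
  have "{S \<in> {S \<in> Pow {1..n}. {1} \<subseteq> S}. card S = k} = insert 1 ` {T. T \<subseteq> {2..n} \<and> card T = k - 1}"
  proof (intro equalityI subsetI)
    fix S assume "S \<in> {S \<in> {S \<in> Pow {1..n}. {1} \<subseteq> S}. card S = k}"
    then have S: "S \<subseteq> {1..n}" "1 \<in> S" "card S = k" by auto
    have "S - {1} \<subseteq> {2..n}" using S(1) by force
    moreover have "card (S - {1}) = k - 1" using S(2,3) by simp
    moreover have "S = insert 1 (S - {1})" using S(2) by blast
    ultimately show "S \<in> insert 1 ` {T. T \<subseteq> {2..n} \<and> card T = k - 1}" by blast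
  next
    fix S assume "S \<in> insert 1 ` {T. T \<subseteq> {2..n} \<and> card T = k - 1}"
    then obtain T where T: "S = insert 1 T" "T \<subseteq> {2..n}" "card T = k - 1" by blast
    have "finite T" "1 \<notin> T" using T(2) finite_subset by auto
    then have "card S = k" using T False by simp
    moreover have "S \<subseteq> {1..n}" using T(1,2) assms by auto
    ultimately show "S \<in> {S \<in> {S \<in> Pow {1..n}. {1} \<subseteq> S}. card S = k}" using T(1) by auto
  qed
  moreover have "inj_on (insert 1) {T. T \<subseteq> {2..n} \<and> card T = k - 1}"
    by (rule inj_on_inverseI[where g = "\<lambda>S. S - {1}"]) auto
  ultimately have "card {S \<in> {S \<in> Pow {1..n}. {1} \<subseteq> S}. card S = k} = card {T. T \<subseteq> {2..n} \<and> card T = k - 1}"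
    by (simp only: card_image)
  then show ?thesis using False n_subsets[of "{2..n}" "k - 1"] by simp
qed

text \<open>
  The level \<open>k\<close> is weighted by \<open>bell0 (n - k)\<close>, which is at least the weight of the level \<open>n - k\<close> if
  \<open>1 \<le> k \<le> n - k\<close>. So the deficit of the level \<open>k\<close> against the star of \<open>1\<close>, nonnegative by
  Erdos-Ko-Rado, outweighs a surplus of the level \<open>n - k\<close>.
\<close>

lemma intersecting_family_bound_one:
  assumes G: "G \<subseteq> Pow {1..n}" "intersecting 1 G" and noX: "\<And>S. S \<in> G \<Longrightarrow> card S \<noteq> 1" and n: "n \<ge> 2"
  shows "card {P \<in> set_partitions n. sing P \<in> G} \<le> Bell (n - 1)"
    and "n \<ge> 3 \<Longrightarrow> card {P \<in> set_partitions n. sing P \<in> G} < Bell (n - 1)"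
proof -
  obtain H where H: "H \<subseteq> Pow {1..n}" "intersecting 1 H" "shifted H"
    and lev: "\<And>j. card {S \<in> H. card S = j} = card {S \<in> G. card S = j}"
    using shifted_family_exists[OF G] by blast
  define g where "g k = card {S \<in> G. card S = k}" for k
  define c where "c k = card {S \<in> {S \<in> Pow {1..n}. {1} \<subseteq> S}. card S = k}" for k
  define d where "d k = (real (c k) - real (g k)) * real (bell0 (n - k))" for k
  have c: "c k = (if k = 0 then 0 else (n - 1) choose (k - 1))" for k
    unfolding c_def by (rule card_star_level) (use n in simp)
  have "{S \<in> G. card S = 1} = {}" using noX by blast
  then have g1: "g 1 = 0" unfolding g_def by (metis card.empty)
  have "{S \<in> G. card S = 0} = {}"
  proof -
    have "card S \<noteq> 0" if "S \<in> G" for S using intersectingD[OF G(2) that that] by simp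
    then show ?thesis by blast
  qed
  then have g0: "g 0 = 0" unfolding g_def by (metis card.empty)
  have NG: "card {P \<in> set_partitions n. sing P \<in> G} = (\<Sum>k\<le>n. g k * bell0 (n - k))"
    using sum_by_card[OF G(1), of "\<lambda>k. bell0 (n - k)"] by (simp add: card_sing_family[OF G(1)] g_def)
  have "Bell (n - 1) = card {P \<in> set_partitions n. {1} \<subseteq> sing P}"
    using card_sing_superset[of "{1}" n] n by simp
  also have "{P \<in> set_partitions n. {1} \<subseteq> sing P} = {P \<in> set_partitions n. sing P \<in> {S \<in> Pow {1..n}. {1} \<subseteq> S}}"
    using sing_subset unfolding set_partitions_def by blast
  also have "card \<dots> = (\<Sum>S\<in>{S \<in> Pow {1..n}. {1} \<subseteq> S}. bell0 (n - card S))"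
    by (rule card_sing_family) auto
  also have "\<dots> = (\<Sum>k\<le>n. c k * bell0 (n - k))"
    unfolding c_def by (rule sum_by_card[where h = "\<lambda>k. bell0 (n - k)"]) auto
  finally have NB: "Bell (n - 1) = (\<Sum>k\<le>n. c k * bell0 (n - k))" .
  have diff: "real (Bell (n - 1)) - real (card {P \<in> set_partitions n. sing P \<in> G}) = (\<Sum>k\<le>n. d k)"
    unfolding NG NB d_def by (simp add: sum_subtractf left_diff_distrib)
  have rev: "(\<Sum>k\<le>n. d (n - k)) = (\<Sum>k\<le>n. d k)"
    by (rule sum.reindex_bij_witness[of _ "\<lambda>k. n - k" "\<lambda>k. n - k"]) auto
  \<comment> \<open>The star attains the bound for complementary levels, by Pascal's rule.\<close>
  have half: "g k + g (n - k) \<le> c k + c (n - k)" if "k \<le> n" for k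
  proof -
    have "g k + g (n - k) \<le> n choose k" unfolding g_def by (rule intersecting_half[OF G(2,1) that])
    also have "\<dots> = c k + c (n - k)"
    proof (cases "k = 0 \<or> k = n")
      case True
      then show ?thesis using n by (auto simp: c)
    next
      case False
      then have k: "1 \<le> k" "k < n" using that by auto
      have "n choose k = ((n - 1) choose (k - 1)) + ((n - 1) choose k)"
        by (rule choose_reduce_nat) (use k in auto)
      moreover have "(n - 1) choose k = (n - 1) choose (n - k - 1)"
        using binomial_symmetric[of k "n - 1"] k by (simp add: diff_commute)
      ultimately show ?thesis using k by (simp add: c)
    qed
    finally show ?thesis .
  qed
  have low: "g k \<le> c k" if "2 * k \<le> n" for k
  proof (cases "k = 0")
    case False
    have "card {S \<in> H. card S = k} \<le> (n - 1) choose (k - 1)"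
    proof (rule Erdos_Ko_Rado_shifted)
      show "intersecting 1 {S \<in> H. card S = k}" using H(2) by (auto simp: intersecting_def)
      show "shifted {S \<in> H. card S = k}"
        unfolding shifted_def
      proof (intro allI impI image_subsetI)
        fix i j :: nat and S assume ij: "1 \<le> i" "i < j" and S: "S \<in> {S \<in> H. card S = k}"
        have "shift i j S \<in> H" using H(3) ij S by (auto simp: shifted_def)
        moreover have "finite S" using S H(1) finite_subset by blast
        ultimately show "shift i j S \<in> {S \<in> H. card S = k}" using S by (simp add: card_shift)
      qed
    qed (use H(1) that False in auto)
    then show ?thesis using False by (simp add: lev g_def c)
  qed (simp add: g0)
  have pair: "0 \<le> d k + d (n - k)" if k: "2 * k \<le> n" for k
  proof (cases "k = 0")
    \<comment> \<open>The weight is not monotone at 0, but neither family has the empty set, so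
      \<open>d 0 = 0\<close> and only the top level remains.\<close>
    case True
    have "real (g n) \<le> real (c n)" using half[of 0] g0 by (simp add: c)
    then show ?thesis using True by (simp add: d_def c g0)
  next
    case False
    have kn: "n - (n - k) = k" using k by simp
    have w: "real (bell0 k) \<le> real (bell0 (n - k))" using bell0_mono[of k "n - k"] k False by simp
    have x: "0 \<le> real (c k) - real (g k)" using low[OF k] by simp
    have "g k + g (n - k) \<le> c k + c (n - k)" using half[of k] k by simp
    then have "- (real (c k) - real (g k)) \<le> real (c (n - k)) - real (g (n - k))" by linarith
    then have "- (real (c k) - real (g k)) * real (bell0 k) \<le> (real (c (n - k)) - real (g (n - k))) * real (bell0 k)"
      by (rule mult_right_mono) simp
    moreover have "(real (c k) - real (g k)) * real (bell0 k) \<le> (real (c k) - real (g k)) * real (bell0 (n - k))"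
      using w x by (rule mult_left_mono)
    ultimately show ?thesis unfolding d_def kn by linarith
  qed
  have pair': "0 \<le> d k + d (n - k)" if "k \<le> n" for k
  proof (cases "2 * k \<le> n")
    case False
    then have "2 * (n - k) \<le> n" by simp
    from pair[OF this] that show ?thesis by (simp add: add.commute)
  qed (rule pair)
  have two: "2 * (\<Sum>k\<le>n. d k) = (\<Sum>k\<le>n. d k + d (n - k))"
    using rev by (simp add: sum.distrib)
  have "0 \<le> (\<Sum>k\<le>n. d k + d (n - k))" by (rule sum_nonneg) (use pair' in auto)
  then show "card {P \<in> set_partitions n. sing P \<in> G} \<le> Bell (n - 1)"
    using two diff by linarith
  assume n3: "n \<ge> 3"
  \<comment> \<open>Strictness comes from the pair of levels 1 and \<open>n - 1\<close>:
    \<open>G\<close> has no singleton sets, and a surplus on level \<open>n - 1\<close> has weight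
    \<open>bell0 1 = 0\<close>. For \<open>n = 2\<close> the level 1 has weight zero too.\<close>
  have "d (n - 1) = 0" using n by (simp add: d_def bell0_1)
  moreover have "bell0 (n - 1) > 0"
  proof -
    have "n - 1 = (n - 3) + 2" using n3 by simp
    then show ?thesis using Bell_le_bell0[of "n - 3"] Bell_pos[of "n - 3"] by (metis le_trans not_less)
  qed
  then have "d 1 > 0" using g1 by (simp add: d_def c)
  ultimately have "0 < (\<Sum>k\<le>n. d k + d (n - k))"
    by (intro sum_pos2[of _ 1]) (use n pair' in auto)
  then show "card {P \<in> set_partitions n. sing P \<in> G} < Bell (n - 1)"
    using two diff by linarith
qed

section \<open>Intersecting families of partitions\<close>

lemma two_le_Bell:
  assumes "m \<ge> 2"
  shows "Bell m \<ge> 2"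
proof -
  obtain i where i: "m = Suc i" "i \<ge> 1" using assms by (cases m) auto
  have "(\<Sum>k\<in>{0, i}. (i choose k) * Bell k) \<le> (\<Sum>k\<le>i. (i choose k) * Bell k)"
    by (rule sum_mono2) auto
  then show ?thesis using i Bell_pos[of i] by (simp add: Bell_Suc)
qed

lemma card_star: "X \<subseteq> {1..n} \<Longrightarrow> card (star n X) = Bell (n - card X)"
  by (simp add: star_eq card_sing_superset)

lemma t_set_imp_star:
  assumes "F \<subseteq> set_partitions n" "intersecting t (sing ` F)" "X \<in> sing ` F" "card X = t"
  shows "F \<subseteq> star n X" "X \<subseteq> {1..n}"
proof -
  show Xn: "X \<subseteq> {1..n}" using assms(1,3) sing_subset by (auto simp: set_partitions_def)
  show "F \<subseteq> star n X"
  proof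
    fix P assume P: "P \<in> F"
    have "finite X" using Xn finite_subset by blast
    moreover have "t \<le> card (sing P \<inter> X)" using intersectingD[OF assms(2) _ assms(3)] P by blast
    ultimately have "sing P \<inter> X = X" using assms(4) by (intro card_seteq) auto
    then show "P \<in> star n X" using P assms(1) unfolding star_eq by blast
  qed
qed

text \<open>A family with at most one member is intersecting for trivial reasons, but
  \<open>t + 2 \<le> n\<close> gives \<open>Bell (n - t) \<ge> 2\<close>. For larger families
  equality forces a \<open>t\<close>-set among the compressed sets of singletons; the compressed
  family is then a full star, and so is \<open>F\<close>.\<close>

lemma t_intersecting_family_bound:
  assumes F: "F \<subseteq> set_partitions n" "t_intersecting_family t F" and n: "t + 2 \<le> n"
    and bound: "\<And>G. G \<subseteq> Pow {1..n} \<Longrightarrow> intersecting t G \<Longrightarrow> (\<And>S. S \<in> G \<Longrightarrow> card S \<noteq> t) \<Longrightarrow>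
      card {P \<in> set_partitions n. sing P \<in> G} < Bell (n - t)"
  shows "card F \<le> Bell (n - t) \<and> (card F = Bell (n - t) \<longrightarrow> (\<exists>X. X \<subseteq> {1..n} \<and> card X = t \<and> F = star n X))"
proof (cases "card F \<ge> 2")
  case False
  have "n - t \<ge> 2" using n by linarith
  then have "card F < Bell (n - t)" using two_le_Bell[of "n - t"] False by linarith
  then show ?thesis by simp
next
  case True
  obtain F' where F': "F' \<subseteq> set_partitions n" "card F' = card F" "intersecting t (sing ` F')"
    and star_back: "\<And>X. X \<subseteq> {1..n} \<Longrightarrow> card X = t \<Longrightarrow> t + 2 \<le> n \<Longrightarrow> F' = star n X \<Longrightarrow> F = star n X"
    by (rule compressed_partition_family_exists[OF F True]) (rule that)
  show ?thesis
  proof (cases "\<exists>X\<in>sing ` F'. card X = t")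
    case True
    then obtain X where X: "X \<in> sing ` F'" "card X = t" by blast
    note sub = t_set_imp_star[OF F'(1,3) X]
    have fin: "finite (star n X)" by (simp add: star_def)
    have cX: "card (star n X) = Bell (n - t)" using card_star[OF sub(2)] X(2) by simp
    have "card F \<le> Bell (n - t)" using card_mono[OF fin sub(1)] cX F'(2) by simp
    moreover have "F = star n X" if "card F = Bell (n - t)"
      using star_back[OF sub(2) X(2) n] card_subset_eq[OF fin sub(1)] cX F'(2) that by simp
    ultimately show ?thesis using sub(2) X(2) by blast
  next
    case False
    have "sing ` F' \<subseteq> Pow {1..n}" using F'(1) sing_subset by (auto simp: set_partitions_def)
    then have "card {P \<in> set_partitions n. sing P \<in> sing ` F'} < Bell (n - t)"
      using bound F'(3) False by blast
    moreover have "card F' \<le> card {P \<in> set_partitions n. sing P \<in> sing ` F'}"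
      by (rule card_mono) (use F'(1) in auto)
    ultimately show ?thesis using F'(2) by simp
  qed
qed

section \<open>Choice of the parameters and the threshold\<close>

lemma half_le_ln_two: "1/2 \<le> ln (2::real)"
proof -
  have "exp 1 \<le> (2::real) ^ 2" using exp_le by simp
  then have "1 \<le> ln ((2::real) ^ 2)" by (subst ln_ge_iff) auto
  also have "\<dots> = 2 * ln 2" by (subst ln_realpow) auto
  finally show ?thesis by simp
qed

text \<open>\<open>k\<close> is about \<open>m / (3 * ln m)\<close>, so
  \<open>k * ln k \<le> m / 3 \<le> m div 2\<close>; replacing 3 by 4 in the lower bound absorbs the
  floor. With \<open>v\<close> about \<open>432 * ln m\<close>, \<open>k * v\<close> is at least
  \<open>m / 4 * 432 = 108 * m\<close>, which becomes \<open>54 * n\<close> once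
  \<open>n \<le> 2 * m\<close>.\<close>

lemma parameters_exist:
  "\<exists>M. \<forall>m\<ge>M. \<exists>k v. k \<ge> 1 \<and> real k * ln (real k) \<le> real (m div 2) \<and> real m / (4 * ln (real m)) \<le> real k
    \<and> 72 * v \<le> k \<and> v \<ge> 1 \<and> m\<^sup>2 \<le> 2 ^ v \<and> 108 * m \<le> k * v \<and> 4 * v \<le> m"
proof -
  have "eventually (\<lambda>m::nat. 72 * (432 * ln (real m) + 1) \<le> real m / (4 * ln (real m))) at_top"
    by real_asymp
  moreover have "eventually (\<lambda>m::nat. 4 * (432 * ln (real m) + 1) \<le> real m) at_top" by real_asymp
  moreover have "eventually (\<lambda>m::nat. 1 \<le> real m / (12 * ln (real m))) at_top" by real_asymp
  moreover have "eventually (\<lambda>m::nat. 1 \<le> ln (real m)) at_top" by real_asymp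
  moreover have "eventually (\<lambda>m::nat. 3 \<le> m) at_top" by (rule eventually_ge_at_top)
  ultimately have "eventually (\<lambda>m::nat. \<exists>k v. k \<ge> 1 \<and> real k * ln (real k) \<le> real (m div 2)
      \<and> real m / (4 * ln (real m)) \<le> real k
      \<and> 72 * v \<le> k \<and> v \<ge> 1 \<and> m\<^sup>2 \<le> 2 ^ v \<and> 108 * m \<le> k * v \<and> 4 * v \<le> m) at_top"
  proof eventually_elim
    case (elim m)
    define L where "L = ln (real m)"
    have L: "L \<ge> 1" using elim(4) by (simp add: L_def)
    define k where "k = nat \<lfloor>real m / (3 * L)\<rfloor>"
    define v where "v = nat \<lceil>432 * L\<rceil>"
    have k1: "real k \<le> real m / (3 * L)" using L by (simp add: k_def)
    have k2: "real m / (4 * L) \<le> real k"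
    proof -
      have "real m / (3 * L) - 1 \<le> real k" unfolding k_def by linarith
      moreover have "real m / (3 * L) = real m / (4 * L) + real m / (12 * L)" using L by (simp add: field_simps)
      ultimately show ?thesis using elim(3) by (simp add: L_def)
    qed
    have v1: "432 * L \<le> real v" unfolding v_def by linarith
    have v2: "real v \<le> 432 * L + 1" unfolding v_def using L by linarith
    have "72 * real v \<le> real k" using v2 elim(1) k2 by (simp add: L_def)
    then have c3: "72 * v \<le> k" by linarith
    have c4: "v \<ge> 1" using v1 L by linarith
    have c1: "k \<ge> 1" using c3 c4 by linarith
    have "real k \<le> real m"
    proof -
      have "real m / (3 * L) \<le> real m / 1" using L by (intro divide_left_mono) auto
      then show ?thesis using k1 by simp
    qed
    then have "ln (real k) \<le> L" using c1 by (simp add: L_def)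
    then have "real k * ln (real k) \<le> (real m / (3 * L)) * L"
      using k1 c1 L by (intro mult_mono) auto
    also have "\<dots> = real m / 3" using L by simp
    also have "\<dots> \<le> real (m div 2)"
    proof -
      have "m \<le> 3 * (m div 2)" using elim(5) by presburger
      then show ?thesis by linarith
    qed
    finally have c2: "real k * ln (real k) \<le> real (m div 2)" .
    have "real m ^ 2 = exp (2 * L)"
      using elim(5) unfolding L_def by (simp add: exp_double)
    also have "\<dots> \<le> exp (real v * ln 2)"
    proof -
      have "2 * L \<le> 432 * L * (1/2)" using L by simp
      also have "\<dots> \<le> real v * ln 2" using v1 L half_le_ln_two by (intro mult_mono) auto
      finally show ?thesis by simp
    qed
    also have "\<dots> = 2 ^ v" by (simp add: exp_of_nat_mult)
    finally have "real (m\<^sup>2) \<le> real (2 ^ v)" by simp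
    then have c5: "m\<^sup>2 \<le> 2 ^ v" by (simp only: of_nat_le_iff)
    have "108 * real m = real m / (4 * L) * (432 * L)" using L by simp
    also have "\<dots> \<le> real k * real v" using k2 v1 L by (intro mult_mono) auto
    finally have "real (108 * m) \<le> real (k * v)" by simp
    then have c6: "108 * m \<le> k * v" by (simp only: of_nat_le_iff)
    have "4 * real v \<le> real m" using v2 elim(2) by (simp add: L_def)
    then have c7: "4 * v \<le> m" by linarith
    show ?case using c1 c2 k2 c3 c4 c5 c6 c7 unfolding L_def by blast
  qed
  then show ?thesis by (simp add: eventually_sequentially)
qed

lemma ln_le_two_sqrt:
  assumes "x > 0"
  shows "ln x \<le> 2 * sqrt x"
proof -
  have "ln x = 2 * ln (sqrt x)" using assms by (simp add: ln_sqrt)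
  also have "\<dots> \<le> 2 * sqrt x" using ln_le_minus_one[of "sqrt x"] assms by simp
  finally show ?thesis .
qed

text \<open>Bootstrapping: if the claim fails, \<open>ln n \<le> 2 * sqrt n\<close> gives
  \<open>sqrt n < 2 ^ 13 * t\<close>, hence \<open>ln n \<le> 28 * ln t\<close>, which contradicts
  the failure. \<open>3456 = 8 * 432\<close> is chosen to give
  \<open>432 * t \<le> m / (4 * ln m)\<close> when \<open>n \<le> 2 * m\<close>;
  \<open>200000\<close> exceeds \<open>3456 * 28 * 2\<close>.\<close>

lemma linear_log_bound:
  fixes t n :: nat
  assumes t: "t \<ge> 2" and n: "real n \<ge> 200000 * real t * (ln (real t))\<^sup>2"
  shows "3456 * real t * ln (real n) \<le> real n"
proof (rule ccontr)
  assume neg: "\<not> ?thesis"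
  define T where "T = ln (real t)"
  have T: "T \<ge> ln 2" using t by (simp add: T_def)
  then have T': "T \<ge> 1/2" using half_le_ln_two by simp
  have "real n > 0"
  proof -
    have "0 < 200000 * real t * T\<^sup>2" using t T' by simp
    then show ?thesis using n by (simp add: T_def)
  qed
  then have sq: "sqrt (real n) > 0" "real n = sqrt (real n) * sqrt (real n)" by simp_all
  have "real n < 3456 * real t * ln (real n)" using neg by simp
  also have "\<dots> \<le> 3456 * real t * (2 * sqrt (real n))"
    using ln_le_two_sqrt[OF \<open>real n > 0\<close>] by (intro mult_left_mono) auto
  finally have "sqrt (real n) * sqrt (real n) < (6912 * real t) * sqrt (real n)" using sq(2) by simp
  then have "sqrt (real n) < 6912 * real t" using sq(1) by (simp only: mult_less_cancel_right_pos)
  also have "\<dots> \<le> 2 ^ 13 * real t" by simp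
  finally have "ln (sqrt (real n)) \<le> ln (2 ^ 13 * real t)"
    using sq(1) t by (subst ln_le_cancel_iff) auto
  also have "\<dots> = ln (2 ^ 13) + T" unfolding T_def by (subst ln_mult_pos) (use t in auto)
  also have "ln ((2::real) ^ 13) = 13 * ln 2" by (subst ln_realpow) auto
  also have "13 * ln 2 + T \<le> 14 * T" using T by simp
  finally have "ln (real n) \<le> 28 * T" using \<open>real n > 0\<close> by (simp add: ln_sqrt)
  then have "3456 * real t * ln (real n) \<le> 3456 * real t * (28 * T)" by (intro mult_left_mono) auto
  also have "\<dots> \<le> 3456 * real t * (28 * T) * (2 * T)"
    using mult_left_mono[of 1 "2 * T" "3456 * real t * (28 * T)"] T' by simp
  also have "\<dots> = 193536 * (real t * T\<^sup>2)" by (simp add: power2_eq_square)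
  also have "\<dots> \<le> 200000 * (real t * T\<^sup>2)" by (intro mult_right_mono) auto
  also have "\<dots> \<le> real n" using n by (simp add: T_def)
  finally show False using neg by simp
qed

lemma large_t_bound:
  "\<exists>C>0. \<forall>n t. t \<ge> 2 \<longrightarrow> real n \<ge> C * real t * (ln (real t))\<^sup>2 \<longrightarrow> t + 2 \<le> n \<and>
    (\<forall>G. G \<subseteq> Pow {1..n} \<longrightarrow> intersecting t G \<longrightarrow> (\<forall>S\<in>G. card S \<noteq> t) \<longrightarrow>
      card {P \<in> set_partitions n. sing P \<in> G} < Bell (n - t))"
proof -
  obtain M where M: "\<And>m. m \<ge> M \<Longrightarrow> \<exists>k v. k \<ge> 1 \<and> real k * ln (real k) \<le> real (m div 2)
      \<and> real m / (4 * ln (real m)) \<le> real k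
      \<and> 72 * v \<le> k \<and> v \<ge> 1 \<and> m\<^sup>2 \<le> 2 ^ v \<and> 108 * m \<le> k * v \<and> 4 * v \<le> m"
    using parameters_exist by blast
  \<comment> \<open>For \<open>t \<ge> 2\<close> the squared logarithm is at least
    \<open>1/4\<close>, so the term in \<open>M\<close> lifts \<open>m = n - t\<close> above the
    threshold of the asymptotic estimates.\<close>
  define C where "C = 200000 + 9 * real M"
  have "t + 2 \<le> n \<and> (\<forall>G. G \<subseteq> Pow {1..n} \<longrightarrow> intersecting t G \<longrightarrow> (\<forall>S\<in>G. card S \<noteq> t) \<longrightarrow>
      card {P \<in> set_partitions n. sing P \<in> G} < Bell (n - t))"
    if t: "t \<ge> 2" and n: "real n \<ge> C * real t * (ln (real t))\<^sup>2" for n t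
  proof -
    have "ln (real t) \<ge> ln 2" using t by simp
    then have "ln (real t) \<ge> 1/2" using half_le_ln_two by linarith
    then have l: "(ln (real t))\<^sup>2 \<ge> 1/4" using power_mono[of "1/2" "ln (real t)" 2] by (simp add: power2_eq_square)
    have "C * real t * (1/4) \<le> real n"
    proof -
      have "C * real t * (1/4) \<le> C * real t * (ln (real t))\<^sup>2"
        by (rule mult_left_mono[OF l]) (simp add: C_def)
      then show ?thesis using n by (rule order_trans)
    qed
    moreover have "C * real t * (1/4) = 50000 * real t + 9/4 * (real M * real t)"
      by (simp add: C_def algebra_simps)
    moreover have "real M * 1 \<le> real M * real t" using t by (intro mult_left_mono) auto
    ultimately have "100 * real t + real M \<le> real n" by simp
    then have nt: "100 * t + M \<le> n" by linarith
    obtain m where m: "n = t + m" using nt by (metis add_leD1 le_add1 le_Suc_ex mult_le_mono1 nat_mult_1 one_le_numeral order_trans)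
    have mM: "m \<ge> M" and n2m: "n \<le> 2 * m" and m2: "m \<ge> 2" using nt m t by simp_all
    obtain k v where kv: "k \<ge> 1" "real k * ln (real k) \<le> real (m div 2)" "real m / (4 * ln (real m)) \<le> real k"
      "72 * v \<le> k" "v \<ge> 1" "m\<^sup>2 \<le> 2 ^ v" "108 * m \<le> k * v" "4 * v \<le> m"
      using M[OF mM] by blast
    have "200000 * real t * (ln (real t))\<^sup>2 \<le> C * real t * (ln (real t))\<^sup>2"
      by (intro mult_right_mono) (auto simp: C_def)
    then have "3456 * real t * ln (real n) \<le> real n" using n by (intro linear_log_bound t) simp
    moreover have "3456 * real t * ln (real m) \<le> 3456 * real t * ln (real n)"
      using m m2 by (intro mult_left_mono) auto
    moreover have "real n \<le> 2 * real m" using n2m by linarith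
    ultimately have "432 * real t * (4 * ln (real m)) \<le> real m" by linarith
    then have "432 * real t \<le> real m / (4 * ln (real m))" using m2 by (simp add: pos_le_divide_eq)
    then have "432 * real t \<le> real k" using kv(3) by linarith
    then have k3: "432 * t \<le> k" by linarith
    have "54 * n \<le> k * v" using n2m kv(7) by linarith
    then have "card {P \<in> set_partitions n. sing P \<in> G} < Bell (n - t)"
      if "G \<subseteq> Pow {1..n}" "intersecting t G" "\<forall>S\<in>G. card S \<noteq> t" for G
      using intersecting_family_bound[of G n t m k v] that t m m2 kv k3 by simp
    moreover have "t + 2 \<le> n" using m m2 by simp
    ultimately show ?thesis by blast
  qed
  moreover have "C > 0" by (simp add: C_def)
  ultimately show ?thesis by blast
qed

text \<open>For \<open>n \<le> 2\<close> the condition \<open>t + 2 \<le> n\<close> fails. For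
  \<open>n = 1\<close> the only partition is the star; for \<open>n = 2\<close> the non-strict bound
  for sets of singletons still gives the inequality.\<close>

lemma one_intersecting_family_bound:
  assumes F: "F \<subseteq> set_partitions n" "t_intersecting_family 1 F" and n: "n \<ge> 1"
  shows "card F \<le> Bell (n - 1) \<and> (card F = Bell (n - 1) \<longrightarrow> n \<noteq> 2 \<longrightarrow>
    (\<exists>X. X \<subseteq> {1..n} \<and> card X = 1 \<and> F = star n X))"
proof -
  consider "n = 1" | "n = 2" | "n \<ge> 3" using n by linarith
  then show ?thesis
  proof cases
    case 1
    have "Bell 1 = 1" using Bell_Suc[of 0] by simp
    then have B: "card (set_partitions 1) = 1" by (simp only: Bell_def)
    have "card F \<le> 1" using card_mono[OF _ F(1)] B 1 by simp
    moreover have "F = star n {1}" if "card F = 1"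
    proof -
      have "star n {1} = set_partitions n"
        using card_subset_eq[of "set_partitions n" "star n {1}"] card_star[of "{1}" n] B 1 by (simp add: star_def)
      moreover have "F = set_partitions n" using card_subset_eq[OF _ F(1)] that B 1 by simp
      ultimately show ?thesis by simp
    qed
    ultimately show ?thesis using 1 by (auto intro!: exI[of _ "{1}"])
  next
    case 2
    have B: "Bell 1 = 1" using Bell_Suc[of 0] by simp
    have "card F \<le> 1"
    proof (rule ccontr)
      assume "\<not> card F \<le> 1"
      then have two: "card F \<ge> 2" by simp
      obtain F' where F': "F' \<subseteq> set_partitions n" "card F' = card F" "intersecting 1 (sing ` F')"
        by (rule compressed_partition_family_exists[OF F two]) (rule that; assumption)
      have "card F' \<le> Bell (n - 1)"
      proof (cases "\<exists>X\<in>sing ` F'. card X = 1")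
        case True
        then obtain X where X: "X \<in> sing ` F'" "card X = 1" by blast
        note sub = t_set_imp_star[OF F'(1,3) X]
        then show ?thesis using card_star[OF sub(2)] X(2) card_mono[of "star n X" F'] by (simp add: star_def)
      next
        case False
        have "sing ` F' \<subseteq> Pow {1..n}" using F'(1) sing_subset by (auto simp: set_partitions_def)
        then have "card {P \<in> set_partitions n. sing P \<in> sing ` F'} \<le> Bell (n - 1)"
          using False F'(3) 2 by (intro intersecting_family_bound_one(1)) auto
        moreover have "card F' \<le> card {P \<in> set_partitions n. sing P \<in> sing ` F'}"
          by (rule card_mono) (use F'(1) in auto)
        ultimately show ?thesis by simp
      qed
      then show False using two F'(2) B 2 by simp
    qed
    then show ?thesis using 2 B by simp
  next
    case 3
    have "card {P \<in> set_partitions n. sing P \<in> G} < Bell (n - 1)"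
      if "G \<subseteq> Pow {1..n}" "intersecting 1 G" "\<And>S. S \<in> G \<Longrightarrow> card S \<noteq> 1" for G
      by (rule intersecting_family_bound_one(2)[OF that]) (use 3 in auto)
    then show ?thesis using t_intersecting_family_bound[OF F] 3 by auto
  qed
qed

(* For n = 2, t = 1 the family whose only member is {{1,2}} also has Bell (n - t) = 1 members;
   this is the reason for the exception in the equality case. *)
theorem theorem2:
  shows "\<exists>C::real. C > 0 \<and>
    (\<forall>(n::nat) (t::nat) (\<F>::nat set set set).
       n \<ge> 1 \<longrightarrow> t \<ge> 1 \<longrightarrow> real n \<ge> C * real t * (ln (real t))\<^sup>2 \<longrightarrow>
       \<F> \<subseteq> set_partitions n \<longrightarrow> t_intersecting_family t \<F> \<longrightarrow>
         card \<F> \<le> Bell (n - t) \<and>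
         (card \<F> = Bell (n - t) \<longrightarrow> \<not> (n = 2 \<and> t = 1) \<longrightarrow>
            (\<exists>X. X \<subseteq> {1..n} \<and> card X = t \<and>
                 \<F> = {P \<in> set_partitions n. \<forall>x\<in>X. {x} \<in> P})))"
proof -
  obtain C where C: "C > 0"
    and large: "\<And>n t. t \<ge> 2 \<Longrightarrow> real n \<ge> C * real t * (ln (real t))\<^sup>2 \<Longrightarrow> t + 2 \<le> n \<and>
      (\<forall>G. G \<subseteq> Pow {1..n} \<longrightarrow> intersecting t G \<longrightarrow> (\<forall>S\<in>G. card S \<noteq> t) \<longrightarrow>
        card {P \<in> set_partitions n. sing P \<in> G} < Bell (n - t))"
    using large_t_bound by blast
  have "card F \<le> Bell (n - t) \<and> (card F = Bell (n - t) \<longrightarrow> \<not> (n = 2 \<and> t = 1) \<longrightarrow>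
      (\<exists>X. X \<subseteq> {1..n} \<and> card X = t \<and> F = star n X))"
    if n: "n \<ge> 1" "t \<ge> 1" "real n \<ge> C * real t * (ln (real t))\<^sup>2"
      and F: "F \<subseteq> set_partitions n" "t_intersecting_family t F" for n t F
  proof (cases "t = 1")
    case True
    then show ?thesis using one_intersecting_family_bound[of F n] F n(1) by auto
  next
    case False
    then have "t \<ge> 2" using n(2) by simp
    note L = large[OF this n(3)]
    have "card F \<le> Bell (n - t) \<and> (card F = Bell (n - t) \<longrightarrow> (\<exists>X. X \<subseteq> {1..n} \<and> card X = t \<and> F = star n X))"
      by (rule t_intersecting_family_bound[OF F]) (use L in blast)+
    then show ?thesis by blast
  qed
  then show ?thesis using C unfolding star_def by blast
qed

end
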